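(* Let $\alpha \in [0,1]$. In single-machine non-clairvoyant preemptive scheduling with a single accurate signal at $\alpha$ (every job $j$ emits its signal exactly when it has been processed for $\alpha p_j$ units of time), consider the algorithm that runs Round-Robin over all unfinished jobs and, whenever a job emits its signal, runs that job alone until its completion and then resumes Round-Robin. This algorithm has competitive ratio $1+\alpha$ for minimizing the total completion time. Moreover, this is optimal: no algorithm in this model, even randomized, has competitive ratio smaller than $1+\alpha$.
   Context: There are $n$ jobs, job $j$ having an unknown processing time $p_j>0$, all available at time $0$, to be processed on a single machine with arbitrary preemption: at each time the machine's unit processing capacity may be split arbitrarily among unfinished jobs. $e_j(t)$ is the processing received by job $j$ up to time $t$; the completion time $C_j$ is the earliest $t$ with $e_j(t)\ge p_j$. The objective is $\mathrm{ALG}=\sum_j C_j$; $\mathrm{OPT}$ is the optimal value (achieved by processing jobs in non-decreasing order of processing time). The scheduler learns $p_j$ only at completion, except for the signal: it is informed at the moment job $j$'s elapsed processing reaches $\alpha p_j$. Round-Robin splits the processing capacity equally among all unfinished jobs. An algorithm has competitive ratio $c$ if $\mathrm{ALG}\le c\cdot \mathrm{OPT}$ on every instance (in expectation for randomized algorithms).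
   Formalization: At α = 0, where all signals come at time 0 and ratio 1 fails for an uninformed scheduler (p=(2,1): 5 vs OPT 4), the signal is taken to reveal p_j and simultaneous signals are served shortest first; for α > 0 this reveals nothing new and ties occur only between equal jobs. *)

theory Defs
  imports "HOL-Probability.Probability"
begin

text \<open>
  An instance consists of the number \<open>n\<close> of jobs, which are named \<open>0, \<dots>, n - 1\<close>, and of their
  processing times \<open>p 0, \<dots>, p (n - 1)\<close>. A schedule \<open>e\<close> is given by the amounts \<open>e j t\<close> of
  processing received up to time \<open>t\<close>; only its values for \<open>j < n\<close> and \<open>0 \<le> t\<close> matter.
\<close>

type_synonym schedule = "nat \<Rightarrow> real \<Rightarrow> real"

type_synonym algorithm = "nat \<Rightarrow> (nat \<Rightarrow> real) \<Rightarrow> schedule"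

definition valid_instance :: "nat \<Rightarrow> (nat \<Rightarrow> real) \<Rightarrow> bool" where
  "valid_instance n p \<longleftrightarrow> (\<forall>j<n. 0 < p j)"

text \<open>
  The third conjunct is the unit capacity of the machine, which may also idle. The last one says
  that finished jobs are not processed. A schedule need not complete all jobs.
\<close>

definition feasible :: "nat \<Rightarrow> (nat \<Rightarrow> real) \<Rightarrow> schedule \<Rightarrow> bool" where
  "feasible n p e \<longleftrightarrow>
     (\<forall>j<n. e j 0 = 0) \<and>
     (\<forall>j<n. \<forall>s t. 0 \<le> s \<and> s \<le> t \<longrightarrow> e j s \<le> e j t) \<and>
     (\<forall>s t. 0 \<le> s \<and> s \<le> t \<longrightarrow> (\<Sum>j<n. e j t - e j s) \<le> t - s) \<and>
     (\<forall>j<n. \<forall>t\<ge>0. e j t \<le> p j)"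

text \<open>The completion time is infinite if the job is never completed.\<close>

definition completion_time :: "(nat \<Rightarrow> real) \<Rightarrow> schedule \<Rightarrow> nat \<Rightarrow> ennreal" where
  "completion_time p e j = (INF t\<in>{t. 0 \<le> t \<and> p j \<le> e j t}. ennreal t)"

definition total_completion_time :: "nat \<Rightarrow> (nat \<Rightarrow> real) \<Rightarrow> schedule \<Rightarrow> ennreal" where
  "total_completion_time n p e = (\<Sum>j<n. completion_time p e j)"

definition opt :: "nat \<Rightarrow> (nat \<Rightarrow> real) \<Rightarrow> ennreal" where
  "opt n p = (INF e\<in>{e. feasible n p e}. total_completion_time n p e)"

text \<open>
  What the scheduler sees of a job with processing time \<open>q\<close> after processing it for \<open>x\<close> units of
  time: the signal, if already emitted, and whether the job is finished. The signal is recorded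
  together with \<open>q\<close>. For \<open>\<alpha> > 0\<close> this gives nothing away, as \<open>x = \<alpha> * q\<close> when the signal is
  emitted; for \<open>\<alpha> = 0\<close> it makes the scheduler clairvoyant from time 0 on.
\<close>

definition observation :: "real \<Rightarrow> real \<Rightarrow> real \<Rightarrow> real option \<times> bool" where
  "observation \<alpha> q x = (if \<alpha> * q \<le> x then Some q else None, q \<le> x)"

definition same_history ::
  "real \<Rightarrow> nat \<Rightarrow> (nat \<Rightarrow> real) \<Rightarrow> schedule \<Rightarrow> (nat \<Rightarrow> real) \<Rightarrow> schedule \<Rightarrow> real \<Rightarrow> bool" where
  "same_history \<alpha> n p e p' e' t \<longleftrightarrow>
     (\<forall>s. 0 \<le> s \<and> s < t \<longrightarrow>
        (\<forall>j<n. observation \<alpha> (p j) (e j s) = observation \<alpha> (p' j) (e' j s)))"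

text \<open>
  An algorithm maps instances to schedules. It is online if the processing up to time \<open>t\<close> depends
  only on \<open>n\<close> and on the observations made before \<open>t\<close>. The histories compared here must not
  contain the schedules themselves, since this would make the condition trivial.
\<close>

definition online_algorithm :: "real \<Rightarrow> algorithm \<Rightarrow> bool" where
  "online_algorithm \<alpha> A \<longleftrightarrow>
     (\<forall>n p. valid_instance n p \<longrightarrow> feasible n p (A n p)) \<and>
     (\<forall>n p p' t. valid_instance n p \<and> valid_instance n p' \<and> 0 \<le> t \<and>
        same_history \<alpha> n p (A n p) p' (A n p') t \<longrightarrow> (\<forall>j<n. A n p j t = A n p' j t))"

definition competitive :: "algorithm \<Rightarrow> real \<Rightarrow> bool" where
  "competitive A c \<longleftrightarrow>
     (\<forall>n p. valid_instance n p \<longrightarrow>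
        total_completion_time n p (A n p) \<le> ennreal c * opt n p)"

text \<open>A randomized algorithm is a random choice among deterministic online algorithms.\<close>

definition randomized_online_algorithm ::
  "real \<Rightarrow> 'w measure \<Rightarrow> ('w \<Rightarrow> algorithm) \<Rightarrow> bool" where
  "randomized_online_algorithm \<alpha> M R \<longleftrightarrow>
     prob_space M \<and>
     (\<forall>\<omega>\<in>space M. online_algorithm \<alpha> (R \<omega>)) \<and>
     (\<forall>n p. valid_instance n p \<longrightarrow>
        (\<lambda>\<omega>. total_completion_time n p (R \<omega> n p)) \<in> borel_measurable M)"

definition competitive_in_expectation ::
  "'w measure \<Rightarrow> ('w \<Rightarrow> algorithm) \<Rightarrow> real \<Rightarrow> bool" where
  "competitive_in_expectation M R c \<longleftrightarrow>
     (\<forall>n p. valid_instance n p \<longrightarrow>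
        (\<integral>\<^sup>+\<omega>. total_completion_time n p (R \<omega> n p) \<partial>M) \<le> ennreal c * opt n p)"

text \<open>
  In the following, \<open>x i\<close> is the processing that job \<open>i\<close> has received so far.
\<close>

definition unfinished :: "nat \<Rightarrow> (nat \<Rightarrow> real) \<Rightarrow> (nat \<Rightarrow> real) \<Rightarrow> nat set" where
  "unfinished n p x = {i. i < n \<and> x i < p i}"

definition signalled :: "real \<Rightarrow> nat \<Rightarrow> (nat \<Rightarrow> real) \<Rightarrow> (nat \<Rightarrow> real) \<Rightarrow> nat set" where
  "signalled \<alpha> n p x = {i \<in> unfinished n p x. \<alpha> * p i \<le> x i}"

text \<open>
  Simultaneous signals are served in order of processing time, then of index. While a job runs
  alone no other job makes progress, so this choice does not change before its completion. Jobs
  signalling together during Round-Robin have received equal processing, so for \<open>\<alpha> > 0\<close> their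
  processing times agree and only the index matters. For \<open>\<alpha> = 0\<close> all jobs signal at time 0, and
  the order of processing times, which is the order of the signals for small \<open>\<alpha> > 0\<close>, is essential.
\<close>

definition next_signalled :: "(nat \<Rightarrow> real) \<Rightarrow> nat set \<Rightarrow> nat" where
  "next_signalled p S = (LEAST i. i \<in> S \<and> (\<forall>k\<in>S. p i \<le> p k))"

definition signal_rr_rate ::
  "real \<Rightarrow> nat \<Rightarrow> (nat \<Rightarrow> real) \<Rightarrow> (nat \<Rightarrow> real) \<Rightarrow> nat \<Rightarrow> real" where
  "signal_rr_rate \<alpha> n p x j =
     (if signalled \<alpha> n p x = {}
      then (if j \<in> unfinished n p x then 1 / real (card (unfinished n p x)) else 0)
      else (if j = next_signalled p (signalled \<alpha> n p x) then 1 else 0))"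

text \<open>
  The received processing is the integral of the rates at which the jobs are processed; the rates
  in turn are functions of the received processing. This determines the schedules produced.
\<close>

definition signal_round_robin :: "real \<Rightarrow> algorithm \<Rightarrow> bool" where
  "signal_round_robin \<alpha> A \<longleftrightarrow>
     (\<forall>n p. valid_instance n p \<longrightarrow>
        (\<forall>j<n. \<forall>t\<ge>0.
           ((\<lambda>s. signal_rr_rate \<alpha> n p (\<lambda>i. A n p i s) j) has_integral A n p j t) {0..t}))"

end

theory Submission
  imports Defs
begin

text \<open>
  Two jobs delay each other by what each receives before the other is finished, and the total
  completion time is at least the sum of the processing times and of these delays, with equality
  for a busy machine. In an optimal schedule the delay of a pair is the smaller processing time.
  Under the algorithm, the longer job of a pair gets no further than the signal of the shorter one
  before the latter is finished, which bounds the delay by \<open>1 + \<alpha>\<close> times the optimal one.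

  For the lower bound the processing times are drawn independently from a Pareto distribution with
  exponent \<open>1/2\<close>, discretised and truncated so that there are finitely many instances and
  randomization can be averaged out. Since the delays dominate for many jobs, it suffices to bound
  the expected delay of two jobs, all others being fixed. Until its first signal the algorithm
  follows a fixed monotone path in the plane of the two received amounts. Its expected cost is at
  least the integral along this path of an exact form, so that it does not depend on the
  path and is \<open>1 + \<alpha>\<close> times the expected minimum, up to lower order terms.
\<close>

text \<open>The tail x^(-1/2) of a processing time gives the minimum of two of them the tail 1/x.
  The expected minimum therefore grows with the logarithm of the truncation point: every scale
  contributes the same amount, and what is lost at the two ends is bounded, against a main term
  proportional to the number of levels. The obstacle is the freedom of the algorithm, which chooses
  the path up to the first signal and, after it, how much more to spend on the job that has not
  signalled. The second choice is a single number per row, and the bound for a row holds for all its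
  values. The first choice cancels: moving the path only transfers a term from a row to a column,
  where it has the same value. What remains is evaluated at extreme ratios of the two levels, where
  the slope is close to 2 or to 2 * \<alpha>; this is the origin of 1 + \<alpha>.\<close>

section \<open>Hitting times and basic properties of schedules\<close>

definition hit :: "(real \<Rightarrow> real) \<Rightarrow> real \<Rightarrow> real" where
  "hit g c = Inf {t. 0 \<le> t \<and> c \<le> g t}"

text \<open>The set defining \<open>hit\<close> is closed by continuity, so it contains its infimum;
  \<open>t0\<close> witnesses that it is nonempty. With \<open>c = p j\<close> this yields
  completion times, with \<open>c = \<alpha> * level i\<close> signal times.\<close>

lemma hit:
  fixes g :: "real \<Rightarrow> real"
  assumes cont: "continuous_on {0..} g" and "0 \<le> t0" "c \<le> g t0"
  shows hit_nonneg: "0 \<le> hit g c" and hit_le: "hit g c \<le> t0" and hit_reached: "c \<le> g (hit g c)"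
    and before_hit: "\<And>s. 0 \<le> s \<Longrightarrow> s < hit g c \<Longrightarrow> g s < c"
proof -
  define S where "S = {t. 0 \<le> t \<and> c \<le> g t}"
  have S: "S = {0..} \<inter> g -` {c..}"
    by (auto simp: S_def)
  have cl: "closed S"
    unfolding S by (rule continuous_closed_preimage[OF cont]) auto
  have ne: "S \<noteq> {}"
    using assms by (auto simp: S_def)
  have bd: "bdd_below S"
    by (rule bdd_belowI[of _ 0]) (auto simp: S_def)
  have "Inf S \<in> S"
    by (rule closed_contains_Inf[OF ne bd cl])
  then show "0 \<le> hit g c" "c \<le> g (hit g c)"
    by (auto simp: hit_def S_def)
  show "hit g c \<le> t0"
    unfolding hit_def using bd assms by (auto intro!: cInf_lower simp: S_def)
  show "g s < c" if "0 \<le> s" "s < hit g c" for s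
  proof (rule ccontr)
    assume "\<not> g s < c"
    then have "s \<in> S" using that by (auto simp: S_def)
    then have "Inf S \<le> s" by (rule cInf_lower[OF _ bd])
    then show False using that by (auto simp: hit_def S_def)
  qed
qed

lemma feasible_mono:
  "feasible n p e \<Longrightarrow> j < n \<Longrightarrow> 0 \<le> s \<Longrightarrow> s \<le> t \<Longrightarrow> e j s \<le> e j t"
  by (auto simp: feasible_def)

lemma feasible_nonneg:
  assumes "feasible n p e" "j < n" "0 \<le> t"
  shows "0 \<le> e j t"
  using feasible_mono[OF assms(1,2), of 0 t] assms by (auto simp: feasible_def)

lemma feasible_le:
  "feasible n p e \<Longrightarrow> j < n \<Longrightarrow> 0 \<le> t \<Longrightarrow> e j t \<le> p j"
  by (auto simp: feasible_def)

lemma feasible_sum_le: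
  assumes "feasible n p e" "0 \<le> t"
  shows "(\<Sum>j<n. e j t) \<le> t"
proof -
  have "(\<Sum>j<n. e j t - e j 0) \<le> t - 0"
    using assms unfolding feasible_def by blast
  moreover have "(\<Sum>j<n. e j t - e j 0) = (\<Sum>j<n. e j t)"
    using assms(1) by (intro sum.cong) (auto simp: feasible_def)
  ultimately show ?thesis by simp
qed

lemma feasible_diff_le:
  assumes "feasible n p e" "j < n" "0 \<le> s" "s \<le> t"
  shows "e j t - e j s \<le> t - s"
proof -
  have "e j t - e j s \<le> (\<Sum>j<n. e j t - e j s)"
    using assms feasible_mono[OF assms(1)] by (intro member_le_sum) auto
  also have "\<dots> \<le> t - s"
    using assms unfolding feasible_def by blast
  finally show ?thesis .
qed

lemma feasible_continuous:
  assumes "feasible n p e" "j < n"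
  shows "continuous_on {0..} (e j)"
proof -
  have "1-lipschitz_on {0..} (e j)"
  proof (rule lipschitz_onI)
    fix s t :: real assume "s \<in> {0..}" "t \<in> {0..}"
    then show "dist (e j s) (e j t) \<le> 1 * dist s t"
      using feasible_diff_le[OF assms, of s t] feasible_diff_le[OF assms, of t s]
        feasible_mono[OF assms, of s t] feasible_mono[OF assms, of t s]
      by (cases "s \<le> t") (auto simp: dist_real_def)
  qed simp
  then show ?thesis by (rule lipschitz_on_continuous_on)
qed

definition finishes :: "(nat \<Rightarrow> real) \<Rightarrow> schedule \<Rightarrow> nat \<Rightarrow> bool" where
  "finishes p e j \<longleftrightarrow> (\<exists>t\<ge>0. p j \<le> e j t)"

abbreviation finish_time :: "(nat \<Rightarrow> real) \<Rightarrow> schedule \<Rightarrow> nat \<Rightarrow> real" where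
  "finish_time p e j \<equiv> hit (e j) (p j)"

lemma finish_time:
  assumes "feasible n p e" "j < n" "finishes p e j"
  shows finish_time_nonneg: "0 \<le> finish_time p e j"
    and at_finish_time: "e j (finish_time p e j) = p j"
    and after_finish_time: "\<And>t. finish_time p e j \<le> t \<Longrightarrow> e j t = p j"
    and before_finish_time: "\<And>s. 0 \<le> s \<Longrightarrow> s < finish_time p e j \<Longrightarrow> e j s < p j"
    and completion_time_eq: "completion_time p e j = ennreal (finish_time p e j)"
proof -
  obtain t0 where t0: "0 \<le> t0" "p j \<le> e j t0"
    using assms(3) by (auto simp: finishes_def)
  note h = hit[OF feasible_continuous[OF assms(1,2)]]
  show 0: "0 \<le> finish_time p e j"
    by (rule h(1)[OF t0])
  have 1: "p j \<le> e j (finish_time p e j)"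
    by (rule h(3)[OF t0])
  with feasible_le[OF assms(1,2) 0] show "e j (finish_time p e j) = p j"
    by linarith
  show "e j t = p j" if "finish_time p e j \<le> t" for t
    using feasible_le[OF assms(1,2), of t] feasible_mono[OF assms(1,2) 0 that] 0 1 that by linarith
  show "e j s < p j" if "0 \<le> s" "s < finish_time p e j" for s
    by (rule h(4)[OF t0 that])
  show "completion_time p e j = ennreal (finish_time p e j)"
    unfolding completion_time_def
  proof (rule antisym)
    show "(INF t\<in>{t. 0 \<le> t \<and> p j \<le> e j t}. ennreal t) \<le> ennreal (finish_time p e j)"
      by (rule INF_lower) (use 0 1 in auto)
    show "ennreal (finish_time p e j) \<le> (INF t\<in>{t. 0 \<le> t \<and> p j \<le> e j t}. ennreal t)"
      by (rule INF_greatest) (auto intro!: ennreal_leI h(2))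
  qed
qed

lemma completion_time_not_finishes:
  assumes "\<not> finishes p e j"
  shows "completion_time p e j = \<top>"
proof -
  have "{t. 0 \<le> t \<and> p j \<le> e j t} = {}"
    using assms by (auto simp: finishes_def)
  then show ?thesis unfolding completion_time_def by simp
qed

lemma total_completion_time_not_finishes:
  assumes "j < n" "\<not> finishes p e j"
  shows "total_completion_time n p e = \<top>"
  unfolding total_completion_time_def
  using assms completion_time_not_finishes[OF assms(2)]
  by (auto simp: ennreal_sum_eq_top)

lemma total_completion_time_eq:
  assumes "feasible n p e" "\<And>j. j < n \<Longrightarrow> finishes p e j"
  shows "total_completion_time n p e = ennreal (\<Sum>j<n. finish_time p e j)"
  unfolding total_completion_time_def
  using completion_time_eq[OF assms(1)] finish_time_nonneg[OF assms(1)] assms(2)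
  by (subst sum_ennreal[symmetric]) (auto intro!: sum.cong)

section \<open>Pairwise delays and the optimum from below\<close>

lemma sum_swap_add:
  fixes f :: "nat \<Rightarrow> nat \<Rightarrow> real"
  shows "(\<Sum>j<n. \<Sum>k<n. f j k + f k j) = 2 * (\<Sum>j<n. \<Sum>k<n. f j k)"
proof -
  have "(\<Sum>j<n. \<Sum>k<n. f k j) = (\<Sum>j<n. \<Sum>k<n. f j k)"
    by (rule sum.swap)
  then show ?thesis by (simp add: sum.distrib)
qed

text \<open>By the completion of \<open>j\<close> the machine has done at most that much work, and
  \<open>e k\<close> at this time is the delay that \<open>k\<close> causes to \<open>j\<close>.
  Putting both directions of a pair together doubles the sum.\<close>

lemma pairwise_delays_le_finish_times:
  assumes "feasible n p e" "\<And>j. j < n \<Longrightarrow> finishes p e j"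
  shows "(\<Sum>j<n. \<Sum>k<n. e k (finish_time p e j) + e j (finish_time p e k))
    \<le> 2 * (\<Sum>j<n. finish_time p e j)"
  unfolding sum_swap_add[of "\<lambda>j k. e k (finish_time p e j)" n]
  using assms by (intro mult_left_mono sum_mono feasible_sum_le finish_time_nonneg) auto

text \<open>The value of shortest-processing-time-first: each job counts its own processing time and
  each unordered pair its minimum. The diagonal of the double sum supplies the second half of every
  \<open>p j\<close>.\<close>

definition spt_cost :: "nat \<Rightarrow> (nat \<Rightarrow> real) \<Rightarrow> real" where
  "spt_cost n p = ((\<Sum>j<n. p j) + (\<Sum>j<n. \<Sum>k<n. min (p j) (p k))) / 2"

lemma spt_cost_alt:
  "2 * spt_cost n p = (\<Sum>j<n. \<Sum>k<n. min (p j) (p k) + (if k = j then p j else 0))"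
  by (simp add: spt_cost_def sum.distrib)

lemma spt_cost_nonneg: "valid_instance n p \<Longrightarrow> 0 \<le> spt_cost n p"
  unfolding spt_cost_def valid_instance_def
  by (intro divide_nonneg_nonneg add_nonneg_nonneg sum_nonneg) (auto intro: less_imp_le)

text \<open>Of two jobs, the one that finishes first is processed in full before the other finishes,
  so the delay is at least the smaller processing time. A schedule that leaves a job unfinished has
  infinite cost.\<close>

lemma opt_ge_spt_cost: "ennreal (spt_cost n p) \<le> opt n p"
  unfolding opt_def
proof (rule INF_greatest)
  fix e assume "e \<in> {e. feasible n p e}"
  then have e: "feasible n p e" by simp
  show "ennreal (spt_cost n p) \<le> total_completion_time n p e"
  proof (cases "\<forall>j<n. finishes p e j")
    case False
    then show ?thesis using total_completion_time_not_finishes by auto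
  next
    case True
    then have fin: "\<And>j. j < n \<Longrightarrow> finishes p e j" by blast
    let ?C = "finish_time p e"
    have "2 * spt_cost n p \<le> (\<Sum>j<n. \<Sum>k<n. e k (?C j) + e j (?C k))"
      unfolding spt_cost_alt
    proof (intro sum_mono)
      fix j k assume "j \<in> {..<n}" "k \<in> {..<n}"
      then have jk: "j < n" "k < n" by auto
      have "e k (?C j) \<ge> 0" "e j (?C k) \<ge> 0"
        using jk fin by (auto intro!: feasible_nonneg[OF e] finish_time_nonneg[OF e])
      moreover have "e j (?C j) = p j" "?C j \<le> ?C k \<Longrightarrow> e j (?C k) = p j"
        "?C k \<le> ?C j \<Longrightarrow> e k (?C j) = p k"
        using jk fin by (auto intro!: at_finish_time[OF e] after_finish_time[OF e])
      ultimately show "min (p j) (p k) + (if k = j then p j else 0) \<le> e k (?C j) + e j (?C k)"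
        by (cases "?C j \<le> ?C k") auto
    qed
    also have "\<dots> \<le> 2 * (\<Sum>j<n. ?C j)"
      by (rule pairwise_delays_le_finish_times[OF e fin])
    finally have "ennreal (spt_cost n p) \<le> ennreal (\<Sum>j<n. ?C j)"
      by (intro ennreal_leI) simp
    also have "\<dots> = total_completion_time n p e"
      by (rule total_completion_time_eq[OF e fin, symmetric])
    finally show ?thesis .
  qed
qed

section \<open>Processing rates of the algorithm\<close>

lemma next_signalled:
  assumes "finite S" "S \<noteq> {}"
  shows next_signalled_in: "next_signalled p S \<in> S"
    and next_signalled_min: "k \<in> S \<Longrightarrow> p (next_signalled p S) \<le> p k"
proof -
  obtain i where i: "i \<in> S" "\<forall>k\<in>S. p i \<le> p k"
    using ex_is_arg_min_if_finite[OF assms, of p]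
    by (auto simp: is_arg_min_linorder)
  then have "next_signalled p S \<in> S \<and> (\<forall>k\<in>S. p (next_signalled p S) \<le> p k)"
    unfolding next_signalled_def by (rule_tac LeastI[of _ i]) auto
  then show "next_signalled p S \<in> S" "k \<in> S \<Longrightarrow> p (next_signalled p S) \<le> p k"
    by auto
qed

text \<open>The strict total order in which simultaneous signals are served; it also settles which
  job of a pair counts as the shorter one.\<close>

definition precedes :: "(nat \<Rightarrow> real) \<Rightarrow> nat \<Rightarrow> nat \<Rightarrow> bool" where
  "precedes p i j \<longleftrightarrow> p i < p j \<or> p i = p j \<and> i < j"

lemma next_signalled_neq:
  assumes "finite S" "i \<in> S" "precedes p i j"
  shows "next_signalled p S \<noteq> j"
proof
  assume eq: "next_signalled p S = j"
  have S: "S \<noteq> {}" using assms by auto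
  have "p j \<le> p k" if "k \<in> S" for k
    using next_signalled_min[OF assms(1) S that, of p] eq by simp
  then have "p i = p j" "i < j" "\<forall>k\<in>S. p i \<le> p k"
    using assms by (force simp: precedes_def)+
  then have "next_signalled p S \<le> i"
    unfolding next_signalled_def using assms by (intro Least_le) auto
  then show False using eq \<open>i < j\<close> by simp
qed

lemma finite_unfinished [simp]: "finite (unfinished n p x)"
  by (simp add: unfinished_def)

lemma signalled_subset: "signalled \<alpha> n p x \<subseteq> unfinished n p x"
  by (auto simp: signalled_def)

lemma finite_signalled [simp]: "finite (signalled \<alpha> n p x)"
  using signalled_subset finite_unfinished by (rule finite_subset)

lemma next_signalled_signalled:
  "signalled \<alpha> n p x \<noteq> {} \<Longrightarrow> next_signalled p (signalled \<alpha> n p x) \<in> signalled \<alpha> n p x"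
  by (simp add: next_signalled_in)

lemma rate_nonneg: "0 \<le> signal_rr_rate \<alpha> n p x j"
  by (simp add: signal_rr_rate_def)

lemma rate_eq_0: "j \<notin> unfinished n p x \<Longrightarrow> signal_rr_rate \<alpha> n p x j = 0"
  using next_signalled_signalled signalled_subset by (fastforce simp: signal_rr_rate_def)

lemma sum_rate:
  "(\<Sum>j<n. signal_rr_rate \<alpha> n p x j) = (if unfinished n p x = {} then 0 else 1)"
proof (cases "signalled \<alpha> n p x = {}")
  case True
  have "{..<n} \<inter> unfinished n p x = unfinished n p x"
    by (auto simp: unfinished_def)
  then have "(\<Sum>j<n. signal_rr_rate \<alpha> n p x j)
      = (\<Sum>j\<in>unfinished n p x. 1 / real (card (unfinished n p x)))"
    using True by (simp add: signal_rr_rate_def sum.If_cases)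
  then show ?thesis by (simp add: card_gt_0_iff)
next
  case False
  then have "next_signalled p (signalled \<alpha> n p x) < n" "unfinished n p x \<noteq> {}"
    using next_signalled_signalled[OF False] by (auto simp: signalled_def unfinished_def)
  then show ?thesis
    using False by (simp add: signal_rr_rate_def)
qed

text \<open>The start is an arbitrary state \<open>x\<close> at an arbitrary time \<open>a\<close>,
  so that a solution can be continued after each signal or completion.\<close>

definition rr_from ::
  "real \<Rightarrow> nat \<Rightarrow> (nat \<Rightarrow> real) \<Rightarrow> (nat \<Rightarrow> real) \<Rightarrow> real \<Rightarrow> schedule \<Rightarrow> bool" where
  "rr_from \<alpha> n p x a e \<longleftrightarrow> (\<forall>j<n. \<forall>t\<ge>a.
     ((\<lambda>s. signal_rr_rate \<alpha> n p (\<lambda>i. e i s) j) has_integral e j t - x j) {a..t})"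

lemma signal_round_robin_iff:
  "signal_round_robin \<alpha> A \<longleftrightarrow>
    (\<forall>n p. valid_instance n p \<longrightarrow> rr_from \<alpha> n p (\<lambda>_. 0) 0 (A n p))"
  by (simp add: signal_round_robin_def rr_from_def)

section \<open>Existence of the algorithm\<close>

lemma rr_from_start:
  assumes "rr_from \<alpha> n p x a e" "j < n"
  shows "e j a = x j"
proof -
  have "((\<lambda>s. signal_rr_rate \<alpha> n p (\<lambda>i. e i s) j) has_integral e j a - x j) {a..a}"
    using assms unfolding rr_from_def by blast
  then have "e j a - x j = 0"
    by (rule has_integral_unique) (simp add: has_integral_refl)
  then show ?thesis by simp
qed

lemma rate_cong:
  assumes "unfinished n p x = unfinished n p y" "signalled \<alpha> n p x = signalled \<alpha> n p y"
  shows "signal_rr_rate \<alpha> n p x j = signal_rr_rate \<alpha> n p y j"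
  by (simp add: signal_rr_rate_def assms)

text \<open>The rates stay constant until the next signal or completion, so that a solution is glued
  together from finitely many linear pieces.\<close>

lemma rr_from_glue:
  assumes "0 \<le> d"
    and const: "\<And>s j. 0 \<le> s \<Longrightarrow> s < d \<Longrightarrow> j < n \<Longrightarrow>
      signal_rr_rate \<alpha> n p (\<lambda>i. x i + s * r i) j = r j"
    and rest: "rr_from \<alpha> n p (\<lambda>i. x i + d * r i) (a + d) e"
  shows "rr_from \<alpha> n p x a (\<lambda>j t. if t < a + d then x j + (t - a) * r j else e j t)"
    (is "rr_from _ _ _ _ _ ?f")
  unfolding rr_from_def
proof (intro allI impI)
  fix j t assume j: "j < n" and t: "a \<le> t"
  let ?g = "\<lambda>s. signal_rr_rate \<alpha> n p (\<lambda>i. ?f i s) j"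
  have lin: "(?g has_integral (s - a) * r j) {a..s}" if s: "a \<le> s" "s \<le> a + d" for s
  proof -
    have "((\<lambda>_. r j) has_integral (s - a) * r j) {a..s}"
      using has_integral_const_real[of "r j" a s] s by simp
    \<comment> \<open>At \<open>a + d\<close> the rate may already have jumped; passing to the open
      interval ignores the endpoints.\<close>
    then have "((\<lambda>_. r j) has_integral (s - a) * r j) {a<..<s}"
      by (simp only: has_integral_Icc_iff_Ioo)
    then have "(?g has_integral (s - a) * r j) {a<..<s}"
      by (rule has_integral_eq[rotated]) (use s j const[of "_ - a" j] in auto)
    then show ?thesis by (simp only: has_integral_Icc_iff_Ioo)
  qed
  show "(?g has_integral ?f j t - x j) {a..t}"
  proof (cases "t < a + d")
    case True
    then show ?thesis using lin[of t] t by simp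
  next
    case False
    have "((\<lambda>s. signal_rr_rate \<alpha> n p (\<lambda>i. e i s) j) has_integral e j t - (x j + d * r j)) {a + d..t}"
      using rest j False by (auto simp: rr_from_def)
    then have "(?g has_integral e j t - (x j + d * r j)) {a + d..t}"
      by (rule has_integral_eq[rotated]) auto
    with lin[of "a + d"] \<open>0 \<le> d\<close> False
    have "(?g has_integral (a + d - a) * r j + (e j t - (x j + d * r j))) {a..t}"
      by (intro has_integral_combine[of a "a + d" t]) auto
    then show ?thesis using False by (simp add: algebra_simps)
  qed
qed

text \<open>Induction on the number of events still to come. A linear piece ends with a completion
  if a signalled job is running and with a signal otherwise, so one cardinality drops and neither
  grows. By \<alpha> \<le> 1 no job finishes before its signal, hence no completion interrupts a
  Round-Robin piece.\<close>

lemma rr_from_exists: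
  assumes "valid_instance n p" "\<alpha> \<le> 1"
  shows "\<exists>e. rr_from \<alpha> n p x a e"
proof (induction "card (unfinished n p x) + card {i. i < n \<and> x i < \<alpha> * p i}"
    arbitrary: x a rule: less_induct)
  case less
  let ?U = "unfinished n p x" and ?S = "signalled \<alpha> n p x" and ?V = "{i. i < n \<and> x i < \<alpha> * p i}"
  define r where "r = signal_rr_rate \<alpha> n p x"
  have step: ?case
    if "0 \<le> d"
      and const: "\<And>s j. 0 \<le> s \<Longrightarrow> s < d \<Longrightarrow> j < n \<Longrightarrow>
        signal_rr_rate \<alpha> n p (\<lambda>i. x i + s * r i) j = r j"
      and le: "card (unfinished n p (\<lambda>i. x i + d * r i))
          + card {i. i < n \<and> x i + d * r i < \<alpha> * p i} < card ?U + card ?V" for d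
    using less[OF le, of "a + d"] rr_from_glue[OF that(1) const] by blast
  have U_sub: "unfinished n p (\<lambda>i. x i + d * r i) \<subseteq> ?U"
    and V_sub: "{i. i < n \<and> x i + d * r i < \<alpha> * p i} \<subseteq> ?V" if "0 \<le> d" for d
    using mult_nonneg_nonneg[OF that rate_nonneg[of \<alpha> n p x]]
    by (auto simp: unfinished_def r_def intro: le_less_trans[rotated])
  consider "?U = {}" | "?S \<noteq> {}" | "?U \<noteq> {}" "?S = {}" by blast
  then show ?case
  proof cases
    case 1
    then have "signal_rr_rate \<alpha> n p x j = 0" for j
      by (simp add: rate_eq_0)
    then have "rr_from \<alpha> n p x a (\<lambda>j t. x j)"
      by (auto simp: rr_from_def)
    then show ?thesis by blast
  next
    case 2
    define k where "k = next_signalled p ?S"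
    have k: "k \<in> ?S" unfolding k_def by (rule next_signalled_signalled[OF 2])
    then have kn: "k < n" "x k < p k" "\<alpha> * p k \<le> x k"
      by (auto simp: signalled_def unfinished_def)
    have r: "r = (\<lambda>j. if j = k then 1 else 0)"
      by (rule ext) (simp only: r_def signal_rr_rate_def k_def 2 if_False simp_thms)
    show ?thesis
    proof (rule step)
      show "0 \<le> p k - x k" using kn by simp
    next
      fix s j assume s: "0 \<le> s" "s < p k - x k" and "j < n"
      have "unfinished n p (\<lambda>i. x i + s * r i) = ?U"
        using s kn by (auto simp: unfinished_def r)
      moreover then have "signalled \<alpha> n p (\<lambda>i. x i + s * r i) = ?S"
        using s kn by (auto simp: signalled_def r unfinished_def split: if_splits)
      ultimately have "signal_rr_rate \<alpha> n p (\<lambda>i. x i + s * r i) j = signal_rr_rate \<alpha> n p x j"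
        by (rule rate_cong)
      then show "signal_rr_rate \<alpha> n p (\<lambda>i. x i + s * r i) j = r j"
        by (simp only: r_def)
    next
      have "unfinished n p (\<lambda>i. x i + (p k - x k) * r i) \<subset> ?U"
        using U_sub[of "p k - x k"] kn by (auto simp: unfinished_def r)
      then have "card (unfinished n p (\<lambda>i. x i + (p k - x k) * r i)) < card ?U"
        by (intro psubset_card_mono) auto
      moreover have "card {i. i < n \<and> x i + (p k - x k) * r i < \<alpha> * p i} \<le> card ?V"
        using V_sub[of "p k - x k"] kn by (intro card_mono) auto
      ultimately show "card (unfinished n p (\<lambda>i. x i + (p k - x k) * r i))
          + card {i. i < n \<and> x i + (p k - x k) * r i < \<alpha> * p i} < card ?U + card ?V"
        by linarith
    qed
  next
    case 3
    define m where "m = real (card ?U)"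
    have m: "0 < m" using 3 by (auto simp: m_def card_gt_0_iff)
    have r: "r = (\<lambda>j. if j \<in> ?U then 1 / m else 0)"
      using 3 by (auto simp: r_def signal_rr_rate_def m_def)
    define g where "g = (\<lambda>i. \<alpha> * p i - x i)"
    \<comment> \<open>The next signal comes from the job that lacks the least processing; at rate
      \<open>1 / m\<close> this takes \<open>m\<close> times as long.\<close>
    define d where "d = m * Min (g ` ?U)"
    have "Min (g ` ?U) \<in> g ` ?U"
      using 3 by (intro Min_in) auto
    then obtain l where l: "l \<in> ?U" "Min (g ` ?U) = g l" by auto
    have ln: "l < n" "x l < \<alpha> * p l"
      using l 3 by (auto simp: signalled_def unfinished_def)
    have gl: "g l \<le> g i" if "i \<in> ?U" for i
      using that unfolding l(2)[symmetric] by (intro Min_le) auto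
    have d0: "0 \<le> d" using m ln l by (simp add: d_def g_def)
    have \<alpha>p: "\<alpha> * p i \<le> p i" if "i < n" for i
      using assms that mult_right_mono[of \<alpha> 1 "p i"] by (auto simp: valid_instance_def less_imp_le)
    show ?thesis
    proof (rule step[OF d0])
      fix s j assume s: "0 \<le> s" "s < d" and "j < n"
      have lt: "x i + s * r i < \<alpha> * p i" if "i \<in> ?U" for i
      proof -
        have "s / m < g l"
          using s(2) m l(2) by (simp add: d_def field_simps)
        with gl[OF that] that show ?thesis by (simp add: r g_def)
      qed
      have "unfinished n p (\<lambda>i. x i + s * r i) = ?U"
        using U_sub[OF s(1)] lt \<alpha>p by (fastforce simp: unfinished_def)
      moreover then have "signalled \<alpha> n p (\<lambda>i. x i + s * r i) = {}"
        using lt by (fastforce simp: signalled_def)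
      ultimately have "signal_rr_rate \<alpha> n p (\<lambda>i. x i + s * r i) j = signal_rr_rate \<alpha> n p x j"
        using 3 by (intro rate_cong) auto
      then show "signal_rr_rate \<alpha> n p (\<lambda>i. x i + s * r i) j = r j"
        by (simp only: r_def)
    next
      have "x l + d * r l = \<alpha> * p l"
        using l m by (simp add: r d_def g_def)
      then have "{i. i < n \<and> x i + d * r i < \<alpha> * p i} \<subset> ?V"
        using V_sub[OF d0] ln by (metis (no_types, lifting) less_irrefl mem_Collect_eq psubsetI)
      then have "card {i. i < n \<and> x i + d * r i < \<alpha> * p i} < card ?V"
        by (intro psubset_card_mono) auto
      moreover have "card (unfinished n p (\<lambda>i. x i + d * r i)) \<le> card ?U"
        using U_sub[OF d0] by (intro card_mono) auto
      ultimately show "card (unfinished n p (\<lambda>i. x i + d * r i))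
          + card {i. i < n \<and> x i + d * r i < \<alpha> * p i} < card ?U + card ?V"
        by linarith
    qed
  qed
qed

lemma signal_round_robin_exists:
  assumes "\<alpha> \<le> 1"
  shows "\<exists>A. signal_round_robin \<alpha> A"
proof -
  have "\<forall>n p. \<exists>e. valid_instance n p \<longrightarrow> rr_from \<alpha> n p (\<lambda>_. 0) 0 e"
    using rr_from_exists assms by blast
  then show ?thesis
    unfolding signal_round_robin_iff by metis
qed

section \<open>The algorithm is online and competitive\<close>

lemma rr_increment:
  assumes "rr_from \<alpha> n p x a e" "j < n" "a \<le> s" "s \<le> t"
  shows "((\<lambda>s. signal_rr_rate \<alpha> n p (\<lambda>i. e i s) j) has_integral e j t - e j s) {s..t}"
proof -
  let ?g = "\<lambda>s. signal_rr_rate \<alpha> n p (\<lambda>i. e i s) j"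
  have g: "(?g has_integral e j u - x j) {a..u}" if "a \<le> u" for u
    using assms that unfolding rr_from_def by blast
  have int: "?g integrable_on {a..t}"
    using g[of t] assms by (auto simp: integrable_on_def)
  then have "?g integrable_on {s..t}"
    by (rule integrable_on_subinterval) (use assms in auto)
  moreover have "integral {a..s} ?g + integral {s..t} ?g = integral {a..t} ?g"
    using assms int by (intro Henstock_Kurzweil_Integration.integral_combine) auto
  moreover have "integral {a..s} ?g = e j s - x j" "integral {a..t} ?g = e j t - x j"
    using g assms by (auto intro!: integral_unique)
  ultimately show ?thesis
    by (simp add: has_integral_integrable_integral)
qed

lemma rr_increment_mono:
  assumes "rr_from \<alpha> n p x a e" "i < n" "j < n" "a \<le> s" "s \<le> t"
    and "\<And>u. s < u \<Longrightarrow> u < t \<Longrightarrow>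
      signal_rr_rate \<alpha> n p (\<lambda>k. e k u) j \<le> signal_rr_rate \<alpha> n p (\<lambda>k. e k u) i"
  shows "e j t - e j s \<le> e i t - e i s"
  using rr_increment[OF assms(1,3,4,5)] rr_increment[OF assms(1,2,4,5)]
  unfolding has_integral_Icc_iff_Ioo
  by (rule has_integral_le) (use assms(6) in auto)

lemma rr_increment_0:
  assumes "rr_from \<alpha> n p x a e" "j < n" "a \<le> s" "s \<le> t"
    and "\<And>u. s < u \<Longrightarrow> u < t \<Longrightarrow> signal_rr_rate \<alpha> n p (\<lambda>k. e k u) j = 0"
  shows "e j t = e j s"
proof -
  have "((\<lambda>u. signal_rr_rate \<alpha> n p (\<lambda>i. e i u) j) has_integral e j t - e j s) {s<..<t}"
    using rr_increment[OF assms(1-4)] by (simp only: has_integral_Icc_iff_Ioo)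
  moreover have "((\<lambda>u. signal_rr_rate \<alpha> n p (\<lambda>i. e i u) j) has_integral 0) {s<..<t}"
    by (rule has_integral_is_0) (use assms(5) in auto)
  ultimately have "e j t - e j s = 0"
    by (rule has_integral_unique)
  then show ?thesis by simp
qed

lemma rr_sum_increment:
  assumes "rr_from \<alpha> n p x a e" "a \<le> s" "s \<le> t"
  shows "((\<lambda>u. if unfinished n p (\<lambda>k. e k u) = {} then 0 else 1)
    has_integral (\<Sum>j<n. e j t - e j s)) {s..t}"
  unfolding sum_rate[of \<alpha> n p, symmetric]
  by (rule has_integral_sum) (auto intro: rr_increment[OF assms(1) _ assms(2,3)])

lemma rr_mono:
  assumes "rr_from \<alpha> n p x a e" "j < n" "a \<le> s" "s \<le> t"
  shows "e j s \<le> e j t"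
  using has_integral_nonneg[OF rr_increment[OF assms] rate_nonneg] by simp

lemma rr_capacity:
  assumes "rr_from \<alpha> n p x a e" "a \<le> s" "s \<le> t"
  shows "(\<Sum>j<n. e j t - e j s) \<le> t - s"
proof -
  have "((\<lambda>_. 1) has_integral t - s) {s..t}"
    using has_integral_const_real[of "1::real" s t] assms by simp
  with rr_sum_increment[OF assms] show ?thesis
    by (rule has_integral_le) auto
qed

lemma rr_busy:
  assumes "rr_from \<alpha> n p x a e" "j < n" "a \<le> s" "s \<le> t"
    and "\<And>u. s < u \<Longrightarrow> u < t \<Longrightarrow> e j u < p j"
  shows "(\<Sum>k<n. e k t - e k s) = t - s"
proof -
  have "((\<lambda>_. 1) has_integral t - s) {s<..<t}"
    using has_integral_const_real[of "1::real" s t] assms(4)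
    by (simp flip: has_integral_Icc_iff_Ioo)
  then have "((\<lambda>u. if unfinished n p (\<lambda>k. e k u) = {} then 0 else 1)
      has_integral t - s) {s<..<t}"
    by (rule has_integral_eq[rotated]) (use assms in \<open>force simp: unfinished_def\<close>)
  with rr_sum_increment[OF assms(1,3,4)] show ?thesis
    unfolding has_integral_Icc_iff_Ioo by (rule has_integral_unique)
qed

lemma rr_lipschitz:
  assumes "rr_from \<alpha> n p x a e" "j < n" "a \<le> s" "s \<le> t"
  shows "e j t - e j s \<le> t - s"
proof -
  have "e j t - e j s \<le> (\<Sum>j<n. e j t - e j s)"
    using assms rr_mono[OF assms(1)] by (intro member_le_sum) auto
  also have "\<dots> \<le> t - s"
    by (rule rr_capacity[OF assms(1,3,4)])
  finally show ?thesis .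
qed

text \<open>The bound by \<open>p j\<close> is the point: a job exceeding it would, by continuity,
  have stood at exactly \<open>p j\<close> before, and from then on its rate is 0.\<close>

lemma rr_feasible:
  assumes p: "valid_instance n p" and e: "rr_from \<alpha> n p (\<lambda>_. 0) 0 e"
  shows "feasible n p e"
proof -
  have "e j t \<le> p j" if jt: "j < n" "0 \<le> t" for j t
  proof (rule ccontr)
    assume "\<not> e j t \<le> p j"
    then have gt: "p j < e j t" by simp
    have cont: "continuous_on {0..t} (e j)"
    proof (rule lipschitz_on_continuous_on[of 1], rule lipschitz_onI)
      fix u v assume "u \<in> {0..t}" "v \<in> {0..t}"
      then show "dist (e j u) (e j v) \<le> 1 * dist u v"
        using rr_lipschitz[OF e jt(1), of u v] rr_lipschitz[OF e jt(1), of v u]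
          rr_mono[OF e jt(1), of u v] rr_mono[OF e jt(1), of v u]
        by (cases "u \<le> v") (auto simp: dist_real_def)
    qed simp
    have "e j 0 \<le> p j"
      using rr_from_start[OF e jt(1)] p jt by (auto simp: valid_instance_def less_imp_le)
    then obtain s where s: "0 \<le> s" "s \<le> t" "e j s = p j"
      using IVT'[of "e j" 0 "p j" t] gt jt cont by auto
    have "e j t = e j s"
    proof (rule rr_increment_0[OF e jt(1) s(1,2)])
      fix u assume "s < u" "u < t"
      then have "p j \<le> e j u" using rr_mono[OF e jt(1) s(1), of u] s by simp
      then show "signal_rr_rate \<alpha> n p (\<lambda>k. e k u) j = 0"
        by (intro rate_eq_0) (auto simp: unfinished_def)
    qed
    then show False using gt s by simp
  qed
  then show ?thesis
    unfolding feasible_def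
    using rr_from_start[OF e] rr_mono[OF e] rr_capacity[OF e] by auto
qed

text \<open>The rates consult processing times only to find out who is unfinished or signalled and
  to rank the signalled jobs. The former is observed directly, and for signalled jobs the
  observation contains \<open>p i\<close>.\<close>

lemma rate_observation_cong:
  assumes obs: "\<And>i. i < n \<Longrightarrow> observation \<alpha> (p i) (x i) = observation \<alpha> (p' i) (x' i)"
  shows "signal_rr_rate \<alpha> n p x = signal_rr_rate \<alpha> n p' x'"
proof -
  have 1: "unfinished n p x = unfinished n p' x'"
    using obs by (auto simp: unfinished_def observation_def not_le[symmetric])
  have 2: "\<alpha> * p i \<le> x i \<longleftrightarrow> \<alpha> * p' i \<le> x' i" "\<alpha> * p i \<le> x i \<Longrightarrow> p i = p' i" if "i < n" for i
    using obs[OF that] by (auto simp: observation_def split: if_splits)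
  then have 3: "signalled \<alpha> n p x = signalled \<alpha> n p' x'"
    unfolding signalled_def 1 by (auto simp: unfinished_def)
  have "p i = p' i" if "i \<in> signalled \<alpha> n p' x'" for i
    using that 2[of i] by (auto simp: signalled_def unfinished_def)
  then have 4: "next_signalled p (signalled \<alpha> n p' x') = next_signalled p' (signalled \<alpha> n p' x')"
    unfolding next_signalled_def by (intro arg_cong[where f = Least]) (auto simp: fun_eq_iff)
  show ?thesis
    unfolding signal_rr_rate_def fun_eq_iff 1 3 4 by simp
qed

lemma signal_round_robin_online:
  assumes A: "signal_round_robin \<alpha> A"
  shows "online_algorithm \<alpha> A"
  unfolding online_algorithm_def
proof (intro conjI allI impI)
  fix n p assume "valid_instance n p"
  then show "feasible n p (A n p)"
    using A rr_feasible unfolding signal_round_robin_iff by blast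
next
  fix n p p' t j
  assume *: "valid_instance n p \<and> valid_instance n p' \<and> 0 \<le> t \<and>
    same_history \<alpha> n p (A n p) p' (A n p') t" and "j < n"
  let ?g = "\<lambda>p s. signal_rr_rate \<alpha> n p (\<lambda>i. A n p i s) j"
  have "(?g p has_integral A n p j t) {0<..<t}" "(?g p' has_integral A n p' j t) {0<..<t}"
    using A * \<open>j < n\<close> unfolding signal_round_robin_def has_integral_Icc_iff_Ioo by blast+
  moreover have "?g p s = ?g p' s" if "s \<in> {0<..<t}" for s
    using * that by (intro fun_cong[OF rate_observation_cong]) (auto simp: same_history_def)
  ultimately show "A n p j t = A n p' j t"
    by (metis (no_types, lifting) has_integral_eq has_integral_unique)
qed

text \<open>The last time \<open>s\<close> at which the bound holds shows that it cannot fail afterwards: if \<open>i\<close> has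
  signalled by then, \<open>j\<close> does not run until \<open>i\<close> is finished; otherwise neither of the two has
  signalled, and for a while \<open>j\<close> does not run faster than \<open>i\<close>.\<close>

lemma rr_later_job_bound:
  assumes p: "valid_instance n p" and \<alpha>: "0 \<le> \<alpha>" and e: "rr_from \<alpha> n p (\<lambda>_. 0) 0 e"
    and ij: "i < n" "j < n" "precedes p i j" and t: "0 \<le> t" "e i t < p i"
  shows "e j t \<le> min (e i t) (\<alpha> * p i)"
proof (rule ccontr)
  assume viol: "\<not> ?thesis"
  have f: "feasible n p e" by (rule rr_feasible[OF p e])
  define D where "D = (\<lambda>s. e j s - min (e i s) (\<alpha> * p i))"
  define S where "S = {0..t} \<inter> D -` {..0}"
  have le: "p i \<le> p j" using ij by (auto simp: precedes_def)
  have "continuous_on {0..t} D"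
    unfolding D_def using ij
    by (intro continuous_intros continuous_on_subset[OF feasible_continuous[OF f]]) auto
  then have "closed S"
    unfolding S_def by (rule continuous_closed_preimage) auto
  then have "compact S"
    by (auto simp: S_def compact_eq_bounded_closed intro: bounded_subset[of "{0..t}"])
  moreover have "0 \<in> S"
  proof -
    have "0 < p i" using p ij by (auto simp: valid_instance_def)
    then have "0 \<le> \<alpha> * p i" using \<alpha> by simp
    then show ?thesis using rr_from_start[OF e] ij t by (simp add: S_def D_def)
  qed
  ultimately obtain s where s: "s \<in> S" "\<And>u. u \<in> S \<Longrightarrow> u \<le> s"
    using compact_attains_sup[of S] by auto
  have st: "0 \<le> s" "s < t" "D s \<le> 0"
    using s(1) viol t by (auto simp: S_def D_def less_le)
  have i_unf: "e i u < p i" if "0 \<le> u" "u \<le> t" for u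
    using rr_mono[OF e ij(1) that] t by simp
  show False
  proof (cases "\<alpha> * p i \<le> e i s")
    case True
    have "e j t = e j s"
    proof (rule rr_increment_0[OF e ij(2)])
      fix u assume u: "s < u" "u < t"
      let ?S = "signalled \<alpha> n p (\<lambda>k. e k u)"
      have "e i s \<le> e i u" using rr_mono[OF e ij(1) st(1)] u by simp
      then have "i \<in> ?S"
        using True i_unf[of u] u st ij by (auto simp: signalled_def unfinished_def)
      then show "signal_rr_rate \<alpha> n p (\<lambda>k. e k u) j = 0"
        using next_signalled_neq[OF finite_signalled _ ij(3)] by (auto simp: signal_rr_rate_def)
    qed (use st in auto)
    then show False
      using viol st True rr_mono[OF e ij(1) st(1), of t] by (auto simp: D_def)
  next
    case False
    then have lt: "e i s < \<alpha> * p i" "e j s < \<alpha> * p i"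
      using st by (auto simp: D_def)
    \<comment> \<open>No job gains more than the elapsed time, so within \<open>d\<close> neither
      job reaches the amount \<open>\<alpha> * p i\<close> at which \<open>i\<close>
      signals.\<close>
    then obtain d where d: "0 < d" "d < \<alpha> * p i - e i s" "d < \<alpha> * p i - e j s"
      using dense[of 0 "min (\<alpha> * p i - e i s) (\<alpha> * p i - e j s)"] by auto
    define u where "u = min t (s + d)"
    have u: "s < u" "u \<le> t" "u - s < \<alpha> * p i - e i s" "u - s < \<alpha> * p i - e j s"
      using d st by (auto simp: u_def min_def)
    have small: "e i u < \<alpha> * p i" "e j u < \<alpha> * p i"
      using rr_lipschitz[OF e ij(1) st(1), of u] rr_lipschitz[OF e ij(2) st(1), of u] u by auto
    have "e j u - e j s \<le> e i u - e i s"
    proof (rule rr_increment_mono[OF e ij(1,2) st(1)])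
      fix w assume w: "s < w" "w < u"
      let ?S = "signalled \<alpha> n p (\<lambda>k. e k w)"
      have "e j w < \<alpha> * p i"
        using rr_mono[OF e ij(2), of w u] w st small by simp
      also have "\<dots> \<le> \<alpha> * p j"
        using le \<alpha> by (rule mult_left_mono)
      finally have "j \<notin> ?S"
        by (auto simp: signalled_def)
      then have "?S \<noteq> {} \<Longrightarrow> next_signalled p ?S \<noteq> j"
        using next_signalled_signalled by metis
      moreover have "i \<in> unfinished n p (\<lambda>k. e k w)"
        using i_unf[of w] w u st ij by (auto simp: unfinished_def)
      ultimately show "signal_rr_rate \<alpha> n p (\<lambda>k. e k w) j \<le> signal_rr_rate \<alpha> n p (\<lambda>k. e k w) i"
        by (auto simp: signal_rr_rate_def)
    qed (use u in auto)
    then have "u \<in> S"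
      using small u st lt by (auto simp: S_def D_def)
    then show False
      using s(2)[of u] u by simp
  qed
qed

text \<open>As long as \<open>j\<close> is unfinished the machine is busy, and by time
  \<open>T\<close> it would have done more work than there is.\<close>

lemma rr_finishes:
  assumes p: "valid_instance n p" and e: "rr_from \<alpha> n p (\<lambda>_. 0) 0 e" and j: "j < n"
  shows "finishes p e j"
proof (rule ccontr)
  assume "\<not> finishes p e j"
  then have unf: "\<And>t. 0 \<le> t \<Longrightarrow> e j t < p j" by (force simp: finishes_def)
  define T where "T = (\<Sum>k<n. p k) + 1"
  have "0 \<le> (\<Sum>k<n. p k)"
    using p by (intro sum_nonneg) (auto simp: valid_instance_def less_imp_le)
  then have T: "0 \<le> T" by (simp add: T_def)
  have "(\<Sum>k<n. e k T - e k 0) = T - 0"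
    by (rule rr_busy[OF e j]) (use T unf in auto)
  moreover have "(\<Sum>k<n. e k T - e k 0) \<le> (\<Sum>k<n. p k)"
    using rr_from_start[OF e] feasible_le[OF rr_feasible[OF p e] _ T] by (intro sum_mono) auto
  ultimately show False by (simp add: T_def)
qed

text \<open>The machine is busy until \<open>j\<close> completes, so \<open>?C j\<close> equals the
  work done by then and the total splits into pairs. The earlier job of a pair contributes at most
  its processing time, the later one at most an \<alpha>-fraction of that.\<close>

lemma rr_total_completion_time_le:
  assumes p: "valid_instance n p" and \<alpha>: "0 \<le> \<alpha>" and e: "rr_from \<alpha> n p (\<lambda>_. 0) 0 e"
  shows "total_completion_time n p e \<le> ennreal ((1 + \<alpha>) * spt_cost n p)"
proof -
  have f: "feasible n p e" by (rule rr_feasible[OF p e])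
  have fin: "finishes p e j" if "j < n" for j by (rule rr_finishes[OF p e that])
  let ?C = "finish_time p e"
  have C0: "0 \<le> ?C j" if "j < n" for j
    using finish_time_nonneg[OF f that fin] that .
  have C: "?C j = (\<Sum>k<n. e k (?C j))" if j: "j < n" for j
  proof -
    have "(\<Sum>k<n. e k (?C j) - e k 0) = ?C j - 0"
      by (rule rr_busy[OF e j]) (use C0 j fin before_finish_time[OF f j] in auto)
    moreover have "(\<Sum>k<n. e k (?C j) - e k 0) = (\<Sum>k<n. e k (?C j))"
      using rr_from_start[OF e] by (intro sum.cong) auto
    ultimately show ?thesis by simp
  qed
  have late: "e j (?C i) \<le> \<alpha> * p i" if ij: "i < n" "j < n" "precedes p i j" for i j
  proof (rule ccontr)
    assume "\<not> ?thesis"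
    then have gt: "\<alpha> * p i < e j (?C i)" by simp
    have pos: "0 < p i" using p ij by (auto simp: valid_instance_def)
    have Ci: "0 < ?C i"
    proof (rule ccontr)
      assume "\<not> 0 < ?C i"
      then have "?C i = 0" using C0[OF ij(1)] by simp
      then show False
        using at_finish_time[OF f ij(1) fin[OF ij(1)]] rr_from_start[OF e ij(1)] pos by simp
    qed
    \<comment> \<open>The bound on \<open>e j\<close> is known only before \<open>i\<close>
      completes. An excess at \<open>?C i\<close> would, by unit speed, be visible slightly
      earlier.\<close>
    define u where "u = max 0 (?C i - (e j (?C i) - \<alpha> * p i) / 2)"
    have u: "0 \<le> u" "u < ?C i" "?C i - u < e j (?C i) - \<alpha> * p i"
      using gt Ci by (auto simp: u_def max_def)
    have "e j u \<le> min (e i u) (\<alpha> * p i)"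
      using before_finish_time[OF f ij(1) fin[OF ij(1)]] u
      by (intro rr_later_job_bound[OF p \<alpha> e ij]) auto
    moreover have "e j (?C i) - e j u \<le> ?C i - u"
      using u by (intro rr_lipschitz[OF e ij(2)]) auto
    ultimately show False using u by simp
  qed
  have pair: "e k (?C j) + e j (?C k) \<le> (1 + \<alpha>) * min (p j) (p k)"
    if jk: "j < n" "k < n" "precedes p j k" for j k
  proof -
    have "min (p j) (p k) = p j" using jk by (auto simp: precedes_def)
    then show ?thesis
      using late[OF jk] feasible_le[OF f jk(1) C0[OF jk(2)]] by (simp add: algebra_simps)
  qed
  have "2 * (\<Sum>j<n. ?C j) = 2 * (\<Sum>j<n. \<Sum>k<n. e k (?C j))"
    using C by simp
  also have "\<dots> = (\<Sum>j<n. \<Sum>k<n. e k (?C j) + e j (?C k))"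
    by (rule sum_swap_add[symmetric])
  also have "\<dots> \<le> (\<Sum>j<n. \<Sum>k<n. (1 + \<alpha>) * (min (p j) (p k) + (if k = j then p j else 0)))"
  proof (intro sum_mono)
    fix j k assume "j \<in> {..<n}" "k \<in> {..<n}"
    then have jk: "j < n" "k < n" by auto
    consider "j = k" | "precedes p j k" | "precedes p k j" "j \<noteq> k"
      by (auto simp: precedes_def) (meson linorder_neqE_nat not_less_iff_gr_or_eq)
    then show "e k (?C j) + e j (?C k) \<le> (1 + \<alpha>) * (min (p j) (p k) + (if k = j then p j else 0))"
    proof cases
      case 1
      have "0 < p j" using p jk by (auto simp: valid_instance_def)
      then have "2 * p j \<le> (1 + \<alpha>) * (2 * p j)" using \<alpha> by (simp add: algebra_simps)
      then show ?thesis using 1 at_finish_time[OF f jk(1) fin[OF jk(1)]] by simp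
    next
      case 2
      then have "j \<noteq> k" by (auto simp: precedes_def)
      then show ?thesis using pair[OF jk 2] by simp
    next
      case 3
      then show ?thesis using pair[OF jk(2,1) 3(1)] by (simp add: min.commute add.commute)
    qed
  qed
  also have "\<dots> = (1 + \<alpha>) * (2 * spt_cost n p)"
    by (simp only: spt_cost_alt sum_distrib_left)
  finally have "ennreal (\<Sum>j<n. ?C j) \<le> ennreal ((1 + \<alpha>) * spt_cost n p)"
    by (intro ennreal_leI) simp
  moreover have "total_completion_time n p e = ennreal (\<Sum>j<n. ?C j)"
    by (rule total_completion_time_eq[OF f fin])
  ultimately show ?thesis by simp
qed

lemma signal_round_robin_competitive:
  assumes "signal_round_robin \<alpha> A" "0 \<le> \<alpha>"
  shows "competitive A (1 + \<alpha>)"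
  unfolding competitive_def
proof (intro allI impI)
  fix n p assume p: "valid_instance n p"
  then have "total_completion_time n p (A n p) \<le> ennreal ((1 + \<alpha>) * spt_cost n p)"
    using assms by (intro rr_total_completion_time_le) (auto simp: signal_round_robin_iff)
  also have "\<dots> = ennreal (1 + \<alpha>) * ennreal (spt_cost n p)"
    using assms spt_cost_nonneg[OF p] by (simp add: ennreal_mult)
  also have "\<dots> \<le> ennreal (1 + \<alpha>) * opt n p"
    using opt_ge_spt_cost by (rule mult_left_mono) simp
  finally show "total_completion_time n p (A n p) \<le> ennreal (1 + \<alpha>) * opt n p" .
qed

text \<open>With \<open>\<alpha> = 0\<close> the algorithm processes the jobs in the order of their processing times.\<close>

lemma opt_eq_spt_cost:
  assumes p: "valid_instance n p"
  shows "opt n p = ennreal (spt_cost n p)"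
proof (rule antisym[OF _ opt_ge_spt_cost])
  obtain e where e: "rr_from 0 n p (\<lambda>_. 0) 0 e"
    using rr_from_exists[OF p, of 0] by auto
  have "opt n p \<le> total_completion_time n p e"
    unfolding opt_def by (rule INF_lower) (use rr_feasible[OF p e] in simp)
  also have "\<dots> \<le> ennreal (spt_cost n p)"
    using rr_total_completion_time_le[OF p _ e] by simp
  finally show "opt n p \<le> ennreal (spt_cost n p)" .
qed

section \<open>The averaging inequality for two jobs\<close>

lemma downward_threshold:
  assumes "\<And>j k :: nat. P k \<Longrightarrow> j \<le> k \<Longrightarrow> P j"
  shows "\<exists>m\<le>N. \<forall>j<N. j < m \<longleftrightarrow> P j"
proof (induction N)
  case 0
  then show ?case by simp
next
  case (Suc N)
  then obtain m where m: "m \<le> N" "\<forall>j<N. j < m \<longleftrightarrow> P j" by blast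
  show ?case
  proof (cases "P N")
    case True
    then have "\<forall>j<Suc N. j < Suc N \<longleftrightarrow> P j" using assms by auto
    then show ?thesis by blast
  next
    case False
    then have "\<forall>j<Suc N. j < m \<longleftrightarrow> P j" using m by (auto simp: less_Suc_eq)
    then show ?thesis using m(1) le_SucI by blast
  qed
qed

text \<open>The processing times are drawn independently from a truncated discrete Pareto distribution
  with exponent \<open>1/2\<close>: level \<open>i\<close> is \<open>\<mu>\<^sup>2\<^sup>i\<close>, and it is reached with probability \<open>1 / \<mu>\<^sup>i\<close>.
  The top level is doubled so that completing a job of that level costs at least as much as
  completing any other job and wasting an \<open>\<alpha>\<close>-fraction of a third one.\<close>

locale pareto_levels =
  fixes \<alpha> \<mu> :: real and K :: nat
  assumes \<alpha>: "0 \<le> \<alpha>" "\<alpha> \<le> 1" and \<mu>: "1 < \<mu>"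
begin

definition level :: "nat \<Rightarrow> real" where
  "level i = (if i < K then \<mu> ^ (2 * i) else 2 * \<mu> ^ (2 * K))"

definition weight :: "nat \<Rightarrow> real" where
  "weight i = (if i < K then (1 - 1 / \<mu>) / \<mu> ^ i else 1 / \<mu> ^ K)"

text \<open>Up to discretisation, \<open>slope I M\<close> is the derivative with respect to \<open>ln I\<close> of the symmetric
  potential \<open>2 * (ln (max I M) + \<alpha> * ln (min I M)) + (1 - \<alpha>) * min I M / max I M\<close>. The symmetry of
  its mixed differences makes the bound independent of the order of the signals.\<close>

definition slope :: "real \<Rightarrow> real \<Rightarrow> real" where
  "slope I M = (if M \<le> I then 2 - (1 - \<alpha>) * M / I else 2 * \<alpha> + (1 - \<alpha>) * \<mu> * I / M)"

definition mixed :: "nat \<Rightarrow> nat \<Rightarrow> real" where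
  "mixed i j = slope (\<mu> ^ i) (\<mu> ^ Suc j) - slope (\<mu> ^ i) (\<mu> ^ j)"

lemma \<mu>_pow_pos [simp]: "0 < \<mu> ^ i"
  using \<mu> by simp

lemma \<mu>_pow_le_iff [simp]: "\<mu> ^ i \<le> \<mu> ^ j \<longleftrightarrow> i \<le> j"
  using \<mu> by (rule power_increasing_iff)

lemma \<alpha>_le: "\<alpha> \<le> \<mu>\<^sup>2"
  using \<alpha> one_le_power[of \<mu> 2] \<mu> by linarith

lemma weight_nonneg: "0 \<le> weight i"
  using \<mu> by (simp add: weight_def)

lemma sum_weight_tail:
  assumes "q \<le> K"
  shows "(\<Sum>j=q..K. weight j) = 1 / \<mu> ^ q"
  using assms
proof (induction rule: inc_induct)
  case base
  then show ?case by (simp add: weight_def)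
next
  case (step q)
  then have "(\<Sum>j=q..K. weight j) = weight q + (\<Sum>j=Suc q..K. weight j)"
    by (simp add: sum.atLeast_Suc_atMost)
  then show ?case
    using step \<mu> by (simp add: weight_def field_simps)
qed

lemma sum_weight: "(\<Sum>j\<le>K. weight j) = 1"
  using sum_weight_tail[of 0] by (simp add: atMost_atLeast0)

lemma level_pos: "0 < level i"
  using \<mu> by (simp add: level_def)

lemma level_mono: "i \<le> j \<Longrightarrow> level i \<le> level j"
proof -
  assume "i \<le> j"
  moreover have "\<mu> ^ (2 * i) \<le> 2 * \<mu> ^ (2 * K)" if "i < K"
  proof -
    have "\<mu> ^ (2 * i) \<le> \<mu> ^ (2 * K)"
      unfolding \<mu>_pow_le_iff using that by simp
    then show ?thesis using \<mu>_pow_pos[of "2 * K"] by linarith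
  qed
  ultimately show ?thesis by (auto simp: level_def)
qed

text \<open>Essentially 2 * I * Q \<le> I^2 + Q^2; for \<mu> close to 1 it is nearly an equality at
  I = Q. The division by \<mu>^2 pays for the discretisation.\<close>

lemma slope_base:
  assumes I: "0 < I" and Q: "0 < Q" and IQ: "Q \<le> I \<or> \<mu> * I \<le> Q"
  shows "I * slope I Q / \<mu>\<^sup>2 \<le> (I\<^sup>2 + \<alpha> * Q\<^sup>2 / \<mu>\<^sup>2) / Q"
proof -
  have \<mu>2: "1 \<le> \<mu>\<^sup>2" "\<mu> \<le> \<mu>\<^sup>2"
    using \<mu> power_increasing[of 0 2 \<mu>] power_increasing[of 1 2 \<mu>] by simp_all
  have "Q * (I * slope I Q) \<le> \<mu>\<^sup>2 * I\<^sup>2 + \<alpha> * Q\<^sup>2"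
  proof (cases "Q \<le> I")
    case True
    have "Q * (I * slope I Q) = 2 * I * Q - (1 - \<alpha>) * Q\<^sup>2"
      using True I by (simp add: slope_def field_simps power2_eq_square)
    also have "\<dots> \<le> I\<^sup>2 + \<alpha> * Q\<^sup>2"
      using zero_le_power2[of "I - Q"] by (simp add: algebra_simps power2_eq_square)
    also have "\<dots> \<le> \<mu>\<^sup>2 * I\<^sup>2 + \<alpha> * Q\<^sup>2"
      using mult_right_mono[OF \<mu>2(1), of "I\<^sup>2"] by simp
    finally show ?thesis .
  next
    case False
    have "Q * (I * slope I Q) = \<alpha> * (2 * I * Q) + (1 - \<alpha>) * (\<mu> * I\<^sup>2)"
      using False Q by (simp add: slope_def field_simps power2_eq_square)
    also have "\<dots> \<le> \<alpha> * (I\<^sup>2 + Q\<^sup>2) + (1 - \<alpha>) * (\<mu> * I\<^sup>2)"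
      using zero_le_power2[of "I - Q"] \<alpha>
      by (intro add_right_mono mult_left_mono) (auto simp: algebra_simps power2_eq_square)
    also have "\<dots> = \<alpha> * I\<^sup>2 + (1 - \<alpha>) * (\<mu> * I\<^sup>2) + \<alpha> * Q\<^sup>2"
      by (simp add: algebra_simps)
    also have "\<dots> \<le> \<alpha> * (\<mu>\<^sup>2 * I\<^sup>2) + (1 - \<alpha>) * (\<mu>\<^sup>2 * I\<^sup>2) + \<alpha> * Q\<^sup>2"
      using \<alpha> \<mu>2 mult_right_mono[OF \<mu>2(1), of "I\<^sup>2"] mult_right_mono[OF \<mu>2(2), of "I\<^sup>2"]
      by (intro add_right_mono add_mono mult_left_mono) auto
    finally show ?thesis by (simp add: algebra_simps)
  qed
  then have "I * slope I Q \<le> (\<mu>\<^sup>2 * I\<^sup>2 + \<alpha> * Q\<^sup>2) / Q"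
    using Q by (simp add: field_simps)
  then have "I * slope I Q / \<mu>\<^sup>2 \<le> (\<mu>\<^sup>2 * I\<^sup>2 + \<alpha> * Q\<^sup>2) / Q / \<mu>\<^sup>2"
    by (rule divide_right_mono) simp
  also have "\<dots> = (I\<^sup>2 + \<alpha> * Q\<^sup>2 / \<mu>\<^sup>2) / Q"
    using \<mu> Q by (simp add: field_simps)
  finally show ?thesis .
qed

text \<open>When one more level \<open>J\<^sup>2\<close> of job 2 is excluded, the slope drops by no
  more than the expected cost at that level; the part of the cost with the minimum already suffices.
  \<open>IJ\<close> expresses that powers of \<mu> do not fall strictly between \<open>J\<close> and
  \<open>\<mu> * J\<close>.\<close>

lemma slope_step:
  assumes I: "0 < I" and J: "0 < J" and IJ: "I \<le> J \<or> \<mu> * J \<le> I"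
  shows "I * (slope I J - slope I (\<mu> * J)) / \<mu>\<^sup>2
    \<le> (1 - 1 / \<mu>) / J * (min (I\<^sup>2) (J\<^sup>2) + \<alpha> * max (I\<^sup>2) (J\<^sup>2))"
proof -
  have JJ: "J < \<mu> * J" using \<mu> J by simp
  have ge: "(1 - 1 / \<mu>) / J * min (I\<^sup>2) (J\<^sup>2)
      \<le> (1 - 1 / \<mu>) / J * (min (I\<^sup>2) (J\<^sup>2) + \<alpha> * max (I\<^sup>2) (J\<^sup>2))"
    using \<mu> J \<alpha> by (intro mult_left_mono) (auto intro!: mult_nonneg_nonneg simp: le_max_iff_disj)
  have \<alpha>\<mu>: "(1 - \<alpha>) / \<mu> \<le> 1" using \<mu> \<alpha> by (simp add: field_simps)
  consider "\<mu> * J \<le> I" | "I = J" | "I < J" using IJ by linarith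
  then have "I * (slope I J - slope I (\<mu> * J)) / \<mu>\<^sup>2 \<le> (1 - 1 / \<mu>) / J * min (I\<^sup>2) (J\<^sup>2)"
  proof cases
    case 1
    then have "J \<le> I" using JJ by linarith
    then have mn: "min (I\<^sup>2) (J\<^sup>2) = J\<^sup>2" using J by (intro min_absorb2 power_mono) auto
    have "I * (slope I J - slope I (\<mu> * J)) / \<mu>\<^sup>2 = (1 - \<alpha>) / \<mu> * ((1 - 1 / \<mu>) * J)"
      using 1 \<open>J \<le> I\<close> I \<mu> by (simp add: slope_def field_simps power2_eq_square)
    also have "\<dots> \<le> 1 * ((1 - 1 / \<mu>) * J)"
      using \<mu> J \<alpha>\<mu> by (intro mult_right_mono) auto
    also have "\<dots> = (1 - 1 / \<mu>) / J * min (I\<^sup>2) (J\<^sup>2)"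
      unfolding mn using J by (simp add: power2_eq_square)
    finally show ?thesis .
  next
    \<comment> \<open>The factor \<mu> in the second branch of \<open>slope\<close> makes both
      values 1 + \<alpha> here.\<close>
    case 2
    then have "slope I J = slope I (\<mu> * J)"
      using J JJ \<mu> by (simp add: slope_def field_simps)
    then show ?thesis using J \<mu> by (simp add: 2)
  next
    case 3
    then have mn: "min (I\<^sup>2) (J\<^sup>2) = I\<^sup>2" using I by (intro min_absorb1 power_mono) auto
    have "I < \<mu> * J" using 3 JJ by linarith
    then have "I * (slope I J - slope I (\<mu> * J)) / \<mu>\<^sup>2 = (1 - \<alpha>) / \<mu> * ((1 - 1 / \<mu>) / J * I\<^sup>2)"
      using 3 J \<mu> by (simp add: slope_def field_simps power2_eq_square)
    also have "\<dots> \<le> 1 * ((1 - 1 / \<mu>) / J * I\<^sup>2)"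
      using \<mu> J \<alpha>\<mu> by (intro mult_right_mono) auto
    finally show ?thesis unfolding mn by simp
  qed
  then show ?thesis using ge by linarith
qed

text \<open>The sum is the expected cost over the levels of job 2 that signal before job 1 is
  finished; the last term is the cost on the remaining tail, of probability
  \<open>1 / \<mu> ^ q\<close>. Any \<open>q\<close> is allowed, that is, any processing granted to
  job 2.\<close>

lemma row_tail:
  assumes "m \<le> q"
  shows "\<mu> ^ i * slope (\<mu> ^ i) (\<mu> ^ m) / \<mu>\<^sup>2 \<le>
    (\<Sum>j=m..<q. (1 - 1 / \<mu>) / \<mu> ^ j *
        (min (\<mu> ^ (2 * i)) (\<mu> ^ (2 * j)) + \<alpha> * max (\<mu> ^ (2 * i)) (\<mu> ^ (2 * j))))
    + (\<mu> ^ (2 * i) + \<alpha> * \<mu> ^ (2 * q) / \<mu>\<^sup>2) / \<mu> ^ q"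
  using assms
proof (induction rule: inc_induct)
  case base
  have "\<mu> ^ q \<le> \<mu> ^ i \<or> \<mu> ^ Suc i \<le> \<mu> ^ q"
    unfolding \<mu>_pow_le_iff by linarith
  then show ?case
    using slope_base[of "\<mu> ^ i" "\<mu> ^ q"] by (simp add: power_even_eq)
next
  case (step m)
  have "\<mu> ^ i \<le> \<mu> ^ m \<or> \<mu> ^ Suc m \<le> \<mu> ^ i"
    unfolding \<mu>_pow_le_iff by linarith
  then have "\<mu> ^ i * (slope (\<mu> ^ i) (\<mu> ^ m) - slope (\<mu> ^ i) (\<mu> ^ Suc m)) / \<mu>\<^sup>2
    \<le> (1 - 1 / \<mu>) / \<mu> ^ m * (min (\<mu> ^ (2 * i)) (\<mu> ^ (2 * m)) + \<alpha> * max (\<mu> ^ (2 * i)) (\<mu> ^ (2 * m)))"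
    using slope_step[of "\<mu> ^ i" "\<mu> ^ m"] by (simp add: power_even_eq)
  then show ?case
    using step by (simp add: sum.atLeast_Suc_lessThan diff_divide_distrib right_diff_distrib)
qed

text \<open>Job \<open>1\<close> has level \<open>i\<close>, and \<open>c j\<close> is the cost if job \<open>2\<close> has level \<open>j\<close>. The predicate \<open>P\<close>
  holds for the levels of job \<open>2\<close> that are excluded before job \<open>1\<close> signals, and \<open>Y\<close> is the
  processing that job \<open>2\<close> receives if it does not signal before job \<open>1\<close> is finished.\<close>

definition row_condition :: "nat \<Rightarrow> (nat \<Rightarrow> bool) \<Rightarrow> (nat \<Rightarrow> real) \<Rightarrow> bool" where
  "row_condition i P c \<longleftrightarrow> (\<forall>k j. P k \<longrightarrow> j \<le> k \<longrightarrow> P j) \<and>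
    (\<exists>Y\<ge>0. (\<forall>j<K. P j \<longrightarrow> \<alpha> * level j \<le> Y) \<and>
      (\<forall>j<K. \<not> P j \<longrightarrow> \<alpha> * level j \<le> Y \<longrightarrow>
        min (level i) (level j) + \<alpha> * max (level i) (level j) \<le> c j) \<and>
      (\<forall>j<K. \<not> P j \<longrightarrow> Y < \<alpha> * level j \<longrightarrow> level i + Y \<le> c j) \<and>
      min (level i + Y) (level K) \<le> c K)"

text \<open>Below \<open>m\<close> lie the levels excluded before the signal of job 1, below
  \<open>q\<close> those whose signal comes with at most \<open>Y\<close> units of processing. The
  mixed differences telescope and move the slope from 1 to \<open>\<mu> ^ m\<close>, where
  \<open>row_tail\<close> applies.\<close>

lemma row_bound:
  assumes row: "row_condition i P c" and i: "i < K"
  shows "\<mu> ^ i / \<mu>\<^sup>2 * (slope (\<mu> ^ i) 1 + (\<Sum>j<K. if P j then mixed i j else 0))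
    \<le> (\<Sum>j<K. if P j then 0 else weight j * (c j + 1)) + weight K * (c K + 1)"
proof -
  from row obtain Y where P: "\<And>k j. P k \<Longrightarrow> j \<le> k \<Longrightarrow> P j" and Y: "0 \<le> Y"
    and Y1: "\<And>j. j < K \<Longrightarrow> P j \<Longrightarrow> \<alpha> * level j \<le> Y"
    and c1: "\<And>j. j < K \<Longrightarrow> \<not> P j \<Longrightarrow> \<alpha> * level j \<le> Y \<Longrightarrow>
        min (level i) (level j) + \<alpha> * max (level i) (level j) \<le> c j"
    and c2: "\<And>j. j < K \<Longrightarrow> \<not> P j \<Longrightarrow> Y < \<alpha> * level j \<Longrightarrow> level i + Y \<le> c j"
    and c3: "min (level i + Y) (level K) \<le> c K"
    unfolding row_condition_def by blast
  obtain m where m: "m \<le> K" "\<forall>j<K. j < m \<longleftrightarrow> P j"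
    using downward_threshold[of P K] P by blast
  have Pm: "j < m \<Longrightarrow> P j" "j < m \<Longrightarrow> j < K" "j < K \<Longrightarrow> P j \<Longrightarrow> j < m" for j
    using m(2) less_le_trans[OF _ m(1)] by blast+
  have "\<alpha> * level j \<le> Y" if "\<alpha> * level k \<le> Y" "j \<le> k" for j k
    using mult_left_mono[OF level_mono[OF that(2)] \<alpha>(1)] that(1) by linarith
  then obtain q where q: "q \<le> K" "\<forall>j<K. j < q \<longleftrightarrow> \<alpha> * level j \<le> Y"
    using downward_threshold[of "\<lambda>j. \<alpha> * level j \<le> Y" K] by blast
  have mq: "m \<le> q"
  proof (rule ccontr)
    assume "\<not> m \<le> q"
    then have "q < m" "q < K" using m(1) by simp_all
    with m(2) q(2) have "q < m \<longleftrightarrow> P q" "q < q \<longleftrightarrow> \<alpha> * level q \<le> Y" by blast+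
    with \<open>q < m\<close> have "P q" "\<not> \<alpha> * level q \<le> Y" by simp_all
    then show False using Y1[OF \<open>q < K\<close>] by blast
  qed
  define b where "b = \<mu> ^ (2 * i) + \<alpha> * \<mu> ^ (2 * q) / \<mu>\<^sup>2"
  \<comment> \<open>For \<open>q > 0\<close> the level below \<open>q\<close> bounds
    \<open>Y\<close> from below. For \<open>q = 0\<close> there is no such level, and the 1 added to
    all costs makes up for it.\<close>
  have qY: "\<alpha> * \<mu> ^ (2 * q) / \<mu>\<^sup>2 \<le> Y + 1"
  proof (cases q)
    case 0
    have "\<alpha> / \<mu>\<^sup>2 \<le> 1" using \<alpha>_le \<mu> by simp
    then show ?thesis using 0 Y by simp
  next
    case (Suc q')
    then have "q' < K" "q' < q" using q(1) by simp_all
    then have "\<alpha> * level q' \<le> Y" using q(2) by blast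
    then show ?thesis using Suc \<mu> \<open>q' < K\<close> by (simp add: level_def power2_eq_square)
  qed
  have late: "b \<le> c j + 1" if "q \<le> j" "j < K" for j
  proof -
    have "\<not> j < q" "\<not> j < m" using that mq by auto
    then have "\<not> \<alpha> * level j \<le> Y" "\<not> P j" using that m q by blast+
    then show ?thesis
      using c2[OF that(2)] qY i by (simp add: b_def level_def)
  qed
  have lateK: "b \<le> c K + 1"
  proof -
    have "b \<le> level K"
    proof -
      have "\<mu> ^ (2 * i) \<le> \<mu> ^ (2 * K)" "\<mu> ^ (2 * q) \<le> \<mu> ^ (2 * K)"
        using i q by auto
      moreover have "\<alpha> * \<mu> ^ (2 * q) / \<mu>\<^sup>2 \<le> \<mu> ^ (2 * q)"
      proof -
        have "\<alpha> * \<mu> ^ (2 * q) \<le> \<mu>\<^sup>2 * \<mu> ^ (2 * q)"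
          using \<alpha>_le by (intro mult_right_mono) auto
        then show ?thesis using \<mu> by (simp add: field_simps)
      qed
      ultimately have "b \<le> 2 * \<mu> ^ (2 * K)" unfolding b_def by linarith
      then show ?thesis by (simp add: level_def)
    qed
    moreover have "b \<le> level i + Y + 1" using qY i by (simp add: b_def level_def)
    ultimately show ?thesis using c3 by linarith
  qed
  have "(\<Sum>j<m. mixed i j) = slope (\<mu> ^ i) (\<mu> ^ m) - slope (\<mu> ^ i) (\<mu> ^ 0)"
    unfolding mixed_def by (rule sum_lessThan_telescope)
  moreover have "(\<Sum>j<K. if P j then mixed i j else 0) = (\<Sum>j<m. mixed i j)"
  proof (rule sum.mono_neutral_cong_right)
    show "{..<m} \<subseteq> {..<K}" using m(1) by simp
    have "\<not> P j" if "j \<in> {..<K} - {..<m}" for j using Pm(3)[of j] that by auto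
    then show "\<forall>j\<in>{..<K} - {..<m}. (if P j then mixed i j else 0) = 0" by presburger
    show "(if P j then mixed i j else 0) = mixed i j" if "j \<in> {..<m}" for j using Pm(1) that by simp
  qed simp
  ultimately have "slope (\<mu> ^ i) 1 + (\<Sum>j<K. if P j then mixed i j else 0) = slope (\<mu> ^ i) (\<mu> ^ m)"
    by simp
  then have "\<mu> ^ i / \<mu>\<^sup>2 * (slope (\<mu> ^ i) 1 + (\<Sum>j<K. if P j then mixed i j else 0))
      = \<mu> ^ i * slope (\<mu> ^ i) (\<mu> ^ m) / \<mu>\<^sup>2"
    by simp
  also have "\<dots> \<le> (\<Sum>j=m..<q. (1 - 1 / \<mu>) / \<mu> ^ j *
        (min (\<mu> ^ (2 * i)) (\<mu> ^ (2 * j)) + \<alpha> * max (\<mu> ^ (2 * i)) (\<mu> ^ (2 * j)))) + b / \<mu> ^ q"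
    unfolding b_def by (rule row_tail[OF mq])
  also have "b / \<mu> ^ q = (\<Sum>j=q..K. weight j * b)"
    using sum_weight_tail[OF q(1)] by (simp flip: sum_distrib_right)
  also have "(\<Sum>j=m..<q. (1 - 1 / \<mu>) / \<mu> ^ j *
        (min (\<mu> ^ (2 * i)) (\<mu> ^ (2 * j)) + \<alpha> * max (\<mu> ^ (2 * i)) (\<mu> ^ (2 * j))))
      \<le> (\<Sum>j=m..<q. weight j * (c j + 1))"
  proof (rule sum_mono)
    fix j assume j: "j \<in> {m..<q}"
    then have "j < K" "\<not> j < m" "j < q" using q by auto
    then have "\<alpha> * level j \<le> Y" "\<not> P j" "j < K" using m q by blast+
    then have "min (\<mu> ^ (2 * i)) (\<mu> ^ (2 * j)) + \<alpha> * max (\<mu> ^ (2 * i)) (\<mu> ^ (2 * j)) \<le> c j + 1"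
      using c1[of j] i by (simp add: level_def)
    then show "(1 - 1 / \<mu>) / \<mu> ^ j *
        (min (\<mu> ^ (2 * i)) (\<mu> ^ (2 * j)) + \<alpha> * max (\<mu> ^ (2 * i)) (\<mu> ^ (2 * j))) \<le> weight j * (c j + 1)"
      using \<open>j < K\<close> \<mu> unfolding weight_def by (simp only: if_True) (intro mult_left_mono, auto)
  qed
  also have "(\<Sum>j=q..K. weight j * b) \<le> (\<Sum>j=q..K. weight j * (c j + 1))"
    using late lateK weight_nonneg by (intro sum_mono mult_left_mono) (auto simp: le_less)
  also have "(\<Sum>j=q..K. weight j * (c j + 1)) = (\<Sum>j=q..<K. weight j * (c j + 1)) + weight K * (c K + 1)"
    using q by (simp add: sum.last_plus add.commute)
  also have "(\<Sum>j=m..<q. weight j * (c j + 1)) + ((\<Sum>j=q..<K. weight j * (c j + 1)) + weight K * (c K + 1))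
      = (\<Sum>j=m..<K. weight j * (c j + 1)) + weight K * (c K + 1)"
    using mq q by (simp add: sum.atLeastLessThan_concat)
  also have "(\<Sum>j=m..<K. weight j * (c j + 1)) = (\<Sum>j<K. if P j then 0 else weight j * (c j + 1))"
  proof (rule sum.mono_neutral_cong_left)
    have "P j" if "j \<in> {..<K} - {m..<K}" for j using Pm(1)[of j] that by auto
    then show "\<forall>j\<in>{..<K} - {m..<K}. (if P j then 0 else weight j * (c j + 1)) = 0" by presburger
    show "weight j * (c j + 1) = (if P j then 0 else weight j * (c j + 1))" if "j \<in> {m..<K}" for j
      using Pm(3)[of j] that by auto
  qed auto
  finally show ?thesis by simp
qed

text \<open>Off the diagonal both sides depend only on the ratio of the smaller to the larger
  power.\<close>

lemma mixed_commute: "mixed i j = mixed j i"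
proof -
  have *: "mixed i j = mixed j i" if "i < j" for i j
  proof -
    have "mixed i j = - (1 - \<alpha>) * (\<mu> - 1) * \<mu> ^ i / \<mu> ^ j"
      using that \<mu> by (simp add: mixed_def slope_def field_simps del: power_Suc) (simp add: field_simps)
    moreover have "mixed j i = - (1 - \<alpha>) * (\<mu> - 1) * \<mu> ^ i / \<mu> ^ j"
      using that \<mu> by (simp add: mixed_def slope_def Suc_le_eq del: power_Suc) (simp add: field_simps)
    ultimately show ?thesis by simp
  qed
  show ?thesis using *[of i j] *[of j i] by (cases i j rule: linorder_cases) auto
qed

text \<open>The main terms are 2 for a small second argument and 2 * \<alpha> for a large one. The
  corrections form the same geometric sum in opposite orders and cancel.\<close>

lemma sum_slopes: "(\<Sum>i<K. slope (\<mu> ^ i) 1 + slope (\<mu> ^ i) (\<mu> ^ K)) = 2 * (1 + \<alpha>) * K"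
proof -
  have "(\<Sum>i<K. 1 / \<mu> ^ i) = (\<Sum>i<K. 1 / \<mu> ^ (K - Suc i))"
    by (rule sum.nat_diff_reindex[symmetric])
  also have "\<dots> = (\<Sum>i<K. \<mu> * \<mu> ^ i / \<mu> ^ K)"
  proof (rule sum.cong)
    fix i assume "i \<in> {..<K}"
    then have "\<mu> ^ K = \<mu> ^ (K - Suc i) * (\<mu> * \<mu> ^ i)"
      by (simp flip: power_add power_Suc)
    then show "1 / \<mu> ^ (K - Suc i) = \<mu> * \<mu> ^ i / \<mu> ^ K" using \<mu> by simp
  qed simp
  finally have eq: "(\<Sum>i<K. 1 / \<mu> ^ i) = (\<Sum>i<K. \<mu> * \<mu> ^ i / \<mu> ^ K)" .
  have "(\<Sum>i<K. slope (\<mu> ^ i) 1 + slope (\<mu> ^ i) (\<mu> ^ K))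
      = (\<Sum>i<K. 2 * (1 + \<alpha>) + ((1 - \<alpha>) * (\<mu> * \<mu> ^ i / \<mu> ^ K) - (1 - \<alpha>) * (1 / \<mu> ^ i)))"
  proof (rule sum.cong)
    fix i assume "i \<in> {..<K}"
    moreover have "1 \<le> \<mu> ^ i" using \<mu> by simp
    ultimately show "slope (\<mu> ^ i) 1 + slope (\<mu> ^ i) (\<mu> ^ K)
        = 2 * (1 + \<alpha>) + ((1 - \<alpha>) * (\<mu> * \<mu> ^ i / \<mu> ^ K) - (1 - \<alpha>) * (1 / \<mu> ^ i))"
      by (simp add: slope_def algebra_simps)
  qed simp
  also have "\<dots> = 2 * (1 + \<alpha>) * K
      + ((1 - \<alpha>) * (\<Sum>i<K. \<mu> * \<mu> ^ i / \<mu> ^ K) - (1 - \<alpha>) * (\<Sum>i<K. 1 / \<mu> ^ i))"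
    by (simp only: sum.distrib sum_subtractf sum_distrib_left) simp
  finally show ?thesis using eq by simp
qed

text \<open>\<open>B i j\<close> stands for job 2 signalling first: row \<open>i\<close> pays for
  the pairs without it, column \<open>j\<close> for those with it. Each mixed difference thus occurs
  once, in a row or in a column, and by symmetry the sum is the same for every \<open>B\<close>. The
  final - 1 is the total weight of the units added to the costs.\<close>

lemma pair_bound:
  assumes rows: "\<And>i. i < K \<Longrightarrow> row_condition i (B i) (c i)"
    and cols: "\<And>j. j < K \<Longrightarrow> row_condition j (\<lambda>i. \<not> B i j) (\<lambda>i. c i j)"
    and cKK: "0 \<le> c K K"
  shows "2 * (1 + \<alpha>) * K * (1 - 1 / \<mu>) / \<mu>\<^sup>2 - 1
    \<le> (\<Sum>i\<le>K. \<Sum>j\<le>K. weight i * weight j * c i j)"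
proof -
  let ?c = "\<lambda>i j. weight i * weight j * (c i j + 1)"
  let ?\<kappa> = "(1 - 1 / \<mu>) / \<mu>\<^sup>2"
  have line: "?\<kappa> * (slope (\<mu> ^ i) 1 + (\<Sum>j<K. if P j then mixed i j else 0))
      \<le> (\<Sum>j<K. if P j then 0 else weight i * weight j * (d j + 1)) + weight i * weight K * (d K + 1)"
    if "row_condition i P d" "i < K" for i P d
  proof -
    have "?\<kappa> * (slope (\<mu> ^ i) 1 + (\<Sum>j<K. if P j then mixed i j else 0))
        = weight i * (\<mu> ^ i / \<mu>\<^sup>2 * (slope (\<mu> ^ i) 1 + (\<Sum>j<K. if P j then mixed i j else 0)))"
      using that \<mu> by (simp add: weight_def)
    also have "\<dots> \<le> weight i *
        ((\<Sum>j<K. if P j then 0 else weight j * (d j + 1)) + weight K * (d K + 1))"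
      by (intro mult_left_mono row_bound that weight_nonneg)
    also have "\<dots> = (\<Sum>j<K. if P j then 0 else weight i * weight j * (d j + 1))
        + weight i * weight K * (d K + 1)"
      by (simp add: distrib_left sum_distrib_left if_distrib mult.assoc cong: if_cong)
    finally show ?thesis .
  qed
  have mixed_sum: "slope (\<mu> ^ i) 1 + (\<Sum>j<K. mixed i j) = slope (\<mu> ^ i) (\<mu> ^ K)" for i
    using sum_lessThan_telescope[of "\<lambda>j. slope (\<mu> ^ i) (\<mu> ^ j)" K] by (simp add: mixed_def)
  have "(\<Sum>i<K. \<Sum>j<K. if B i j then mixed i j else 0) + (\<Sum>j<K. \<Sum>i<K. if \<not> B i j then mixed j i else 0)
      = (\<Sum>i<K. \<Sum>j<K. (if B i j then mixed i j else 0) + (if \<not> B i j then mixed j i else 0))"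
    by (subst sum.swap[of "\<lambda>j i. if \<not> B i j then mixed j i else 0"]) (simp add: sum.distrib)
  also have "\<dots> = (\<Sum>i<K. \<Sum>j<K. mixed i j)"
    using mixed_commute by (intro sum.cong) auto
  finally have "2 * (1 + \<alpha>) * K = (\<Sum>i<K. slope (\<mu> ^ i) 1 + (\<Sum>j<K. if B i j then mixed i j else 0))
      + (\<Sum>j<K. slope (\<mu> ^ j) 1 + (\<Sum>i<K. if \<not> B i j then mixed j i else 0))"
    unfolding sum_slopes[symmetric] mixed_sum[symmetric] by (simp add: sum.distrib flip: sum_distrib_left)
  then have "?\<kappa> * (2 * (1 + \<alpha>) * K)
      = (\<Sum>i<K. ?\<kappa> * (slope (\<mu> ^ i) 1 + (\<Sum>j<K. if B i j then mixed i j else 0)))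
      + (\<Sum>j<K. ?\<kappa> * (slope (\<mu> ^ j) 1 + (\<Sum>i<K. if \<not> B i j then mixed j i else 0)))"
    by (simp only: distrib_left[of ?\<kappa>] sum_distrib_left)
  also have "\<dots> \<le> (\<Sum>i<K. (\<Sum>j<K. if B i j then 0 else ?c i j) + ?c i K)
      + (\<Sum>j<K. (\<Sum>i<K. if \<not> B i j then 0 else ?c i j) + ?c K j)"
  proof (intro add_mono sum_mono)
    fix j assume "j \<in> {..<K}"
    then have j: "j < K" by simp
    have "?c i j = weight j * weight i * (c i j + 1)" for i
      by simp
    then show "?\<kappa> * (slope (\<mu> ^ j) 1 + (\<Sum>i<K. if \<not> B i j then mixed j i else 0))
        \<le> (\<Sum>i<K. if \<not> B i j then 0 else ?c i j) + ?c K j"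
      using line[OF cols[OF j] j] by (simp only:)
  qed (use line[OF rows] in simp)
  also have "\<dots> = (\<Sum>i<K. \<Sum>j<K. (if B i j then 0 else ?c i j) + (if \<not> B i j then 0 else ?c i j))
      + (\<Sum>i<K. ?c i K) + (\<Sum>j<K. ?c K j)"
    using sum.swap[of "\<lambda>j i. if \<not> B i j then 0 else ?c i j" "{..<K}" "{..<K}"]
    by (simp only: sum.distrib add_ac)
  also have "\<dots> = (\<Sum>i<K. \<Sum>j<K. ?c i j) + (\<Sum>i<K. ?c i K) + (\<Sum>j<K. ?c K j)"
    by (intro arg_cong2[where f = "(+)"] refl sum.cong) auto
  also have "\<dots> \<le> (\<Sum>i<K. \<Sum>j<K. ?c i j) + (\<Sum>i<K. ?c i K) + (\<Sum>j<K. ?c K j) + ?c K K"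
    using cKK weight_nonneg by simp
  also have "\<dots> = (\<Sum>i\<le>K. \<Sum>j\<le>K. ?c i j)"
    by (simp add: sum.distrib flip: lessThan_Suc_atMost)
  also have "\<dots> = (\<Sum>i\<le>K. \<Sum>j\<le>K. weight i * weight j * c i j) + (\<Sum>i\<le>K. \<Sum>j\<le>K. weight i * weight j)"
    by (simp add: distrib_left sum.distrib)
  also have "(\<Sum>i\<le>K. \<Sum>j\<le>K. weight i * weight j) = 1"
    using sum_weight by (simp flip: sum_product)
  finally show ?thesis by (simp add: mult.commute)
qed

text \<open>Split the inner sum at \<open>i\<close>: the shorter levels contribute a geometric sum
  of at most \<open>\<mu> ^ i\<close>, the others \<open>level i\<close> times their probability.
  Weighted, each level below \<open>K\<close> gives twice \<open>1 - 1 / \<mu>\<close>.\<close>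

lemma expected_min_le:
  "(\<Sum>i\<le>K. \<Sum>j\<le>K. weight i * weight j * min (level i) (level j)) \<le> 2 * K * (1 - 1 / \<mu>) + 3"
proof -
  have short: "(\<Sum>j<i. weight j * level j) \<le> \<mu> ^ i" if "i \<le> K" for i
    using that
  proof (induction i)
    case (Suc i)
    have "(\<Sum>j<Suc i. weight j * level j) \<le> \<mu> ^ i + weight i * level i"
      using Suc by simp
    also have "weight i * level i = (1 - 1 / \<mu>) * \<mu> ^ i"
      using Suc \<mu> by (simp add: weight_def level_def power_even_eq power2_eq_square)
    also have "\<dots> \<le> (\<mu> - 1) * \<mu> ^ i"
      using \<mu> mult_nonneg_nonneg[of "\<mu> - 1" "\<mu> - 1"]
      by (intro mult_right_mono) (auto simp: field_simps)
    finally show ?case by (simp add: algebra_simps)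
  qed simp
  have row: "(\<Sum>j\<le>K. weight j * min (level i) (level j)) \<le> \<mu> ^ i + level i / \<mu> ^ i" if i: "i \<le> K" for i
  proof -
    have "(\<Sum>j\<le>K. weight j * min (level i) (level j))
        = (\<Sum>j<i. weight j * min (level i) (level j)) + (\<Sum>j=i..K. weight j * min (level i) (level j))"
      using i by (subst sum.union_disjoint[symmetric]) (auto intro!: sum.cong)
    also have "(\<Sum>j=i..K. weight j * min (level i) (level j)) \<le> (\<Sum>j=i..K. weight j * level i)"
      using weight_nonneg by (intro sum_mono mult_left_mono) auto
    also have "\<dots> = level i / \<mu> ^ i"
      using sum_weight_tail[OF i] by (simp flip: sum_distrib_right)
    also have "(\<Sum>j<i. weight j * min (level i) (level j)) \<le> (\<Sum>j<i. weight j * level j)"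
      using weight_nonneg by (intro sum_mono mult_left_mono) auto
    also have "\<dots> \<le> \<mu> ^ i" by (rule short[OF i])
    finally show ?thesis by simp
  qed
  have "(\<Sum>i\<le>K. \<Sum>j\<le>K. weight i * weight j * min (level i) (level j))
      = (\<Sum>i\<le>K. weight i * (\<Sum>j\<le>K. weight j * min (level i) (level j)))"
    by (simp add: sum_distrib_left mult.assoc)
  also have "\<dots> \<le> (\<Sum>i\<le>K. weight i * (\<mu> ^ i + level i / \<mu> ^ i))"
    using weight_nonneg row by (intro sum_mono mult_left_mono) auto
  \<comment> \<open>The top level gives 1 + 2, the 2 coming from its doubling.\<close>
  also have "\<dots> = (\<Sum>i<K. weight i * (\<mu> ^ i + level i / \<mu> ^ i)) + 3"
    using \<mu> by (simp add: weight_def level_def power_even_eq power2_eq_square add_divide_distrib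
        flip: lessThan_Suc_atMost)
  also have "(\<Sum>i<K. weight i * (\<mu> ^ i + level i / \<mu> ^ i)) = (\<Sum>i<K. 2 * (1 - 1 / \<mu>))"
    using \<mu> by (intro sum.cong) (simp_all add: weight_def level_def power_even_eq power2_eq_square)
  finally show ?thesis by (simp add: algebra_simps)
qed

end

section \<open>Two jobs under an online algorithm\<close>

text \<open>A threshold that is reached stays reached by monotonicity; one that is missed is missed
  for a while by continuity.\<close>

lemma observation_right:
  assumes e: "feasible n p e" and k: "k < n" and s: "0 \<le> s"
  shows "\<forall>\<^sub>F u in at_right s. observation \<alpha> (p k) (e k u) = observation \<alpha> (p k) (e k s)"
proof -
  have ev: "\<forall>\<^sub>F u in at_right s. c \<le> e k u \<longleftrightarrow> c \<le> e k s" for c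
  proof (cases "c \<le> e k s")
    case True
    have "c \<le> e k u" if "s < u" for u
      using feasible_mono[OF e k s, of u] that True by simp
    then show ?thesis
      using True eventually_at_right_less[of s] by (auto elim: eventually_mono)
  next
    case False
    have "(e k \<longlongrightarrow> e k s) (at s within {0..})"
      using feasible_continuous[OF e k] s by (simp add: continuous_on_def)
    then have "(e k \<longlongrightarrow> e k s) (at_right s)"
      by (rule tendsto_within_subset) (use s in auto)
    then have "\<forall>\<^sub>F u in at_right s. e k u < c"
      using False by (intro order_tendstoD(2)) auto
    then show ?thesis using False by (auto elim: eventually_mono)
  qed
  show ?thesis
    using ev[of "\<alpha> * p k"] ev[of "p k"] by eventually_elim (simp add: observation_def)
qed

text \<open>An online algorithm treats two instances alike as long as no signal of a job tells them
  apart. The observations are right-continuous, so that the first time of disagreement cannot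
  come before such a signal.\<close>

lemma online_sync:
  assumes A: "online_algorithm \<alpha> A" and p: "valid_instance n p" "valid_instance n p'"
    and \<alpha>: "0 \<le> \<alpha>" "\<alpha> \<le> 1" and t: "0 \<le> t"
    and agree: "\<And>s k. 0 \<le> s \<Longrightarrow> s < t \<Longrightarrow> k < n \<Longrightarrow>
      p k = p' k \<or> A n p k s < \<alpha> * p k \<and> A n p k s < \<alpha> * p' k"
    and s: "0 \<le> s" "s \<le> t" and k: "k < n"
  shows "A n p k s = A n p' k s"
proof -
  let ?H = "same_history \<alpha> n p (A n p) p' (A n p')"
  have f: "feasible n p (A n p)" "feasible n p' (A n p')"
    using A p by (auto simp: online_algorithm_def)
  have eq: "A n p k r = A n p' k r" if "?H r" "0 \<le> r" "k < n" for r k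
    using A p that by (auto simp: online_algorithm_def)
  define G where "G = {r. 0 \<le> r \<and> r \<le> t \<and> ?H r}"
  have G0: "0 \<in> G" using t by (auto simp: G_def same_history_def)
  have bdd: "bdd_above G" by (rule bdd_aboveI[of _ t]) (auto simp: G_def)
  define \<sigma> where "\<sigma> = Sup G"
  have \<sigma>: "0 \<le> \<sigma>" "\<sigma> \<le> t"
    unfolding \<sigma>_def using cSup_upper[OF G0 bdd] G0 by (auto intro!: cSup_least simp: G_def)
  \<comment> \<open>A history covers only times strictly before its end, so agreement passes to the
    supremum.\<close>
  have H: "?H \<sigma>"
    unfolding same_history_def
  proof (intro allI impI)
    fix u k assume u: "0 \<le> u \<and> u < \<sigma>" and k: "k < n"
    then obtain r where "r \<in> G" "u < r"
      using less_cSup_iff[OF _ bdd, of u] G0 unfolding \<sigma>_def by blast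
    then show "observation \<alpha> (p k) (A n p k u) = observation \<alpha> (p' k) (A n p' k u)"
      using u k by (auto simp: G_def same_history_def)
  qed
  have "\<sigma> = t"
  proof (rule ccontr)
    assume "\<sigma> \<noteq> t"
    then have \<sigma>t: "\<sigma> < t" using \<sigma> by simp
    \<comment> \<open>At \<sigma> the schedules still coincide by the online property. A job whose
      processing times differ is below both of its signals, so nothing of it is observed in either
      run.\<close>
    have at_\<sigma>: "observation \<alpha> (p k) (A n p k \<sigma>) = observation \<alpha> (p' k) (A n p' k \<sigma>)" if k: "k < n" for k
    proof (cases "p k = p' k")
      case True
      then show ?thesis using eq[OF H \<sigma>(1) k] by simp
    next
      case False
      then have "A n p k \<sigma> < \<alpha> * p k" "A n p' k \<sigma> < \<alpha> * p' k"
        using agree[OF \<sigma>(1) \<sigma>t k] eq[OF H \<sigma>(1) k] by auto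
      moreover have "\<alpha> * p k \<le> p k" "\<alpha> * p' k \<le> p' k"
        using p k \<alpha> mult_right_mono[of \<alpha> 1 "p k"] mult_right_mono[of \<alpha> 1 "p' k"]
        by (auto simp: valid_instance_def less_imp_le)
      ultimately show ?thesis by (auto simp: observation_def)
    qed
    have "\<forall>\<^sub>F u in at_right \<sigma>.
        observation \<alpha> (p k) (A n p k u) = observation \<alpha> (p' k) (A n p' k u)" if k: "k < n" for k
      using observation_right[OF f(1) k \<sigma>(1), of \<alpha>] observation_right[OF f(2) k \<sigma>(1), of \<alpha>]
      by eventually_elim (simp add: at_\<sigma>[OF k])
    then have "\<forall>\<^sub>F u in at_right \<sigma>. \<forall>k\<in>{..<n}.
        observation \<alpha> (p k) (A n p k u) = observation \<alpha> (p' k) (A n p' k u)"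
      by (intro eventually_ball_finite) auto
    then obtain d where d: "\<sigma> < d" "\<And>u k. \<sigma> < u \<Longrightarrow> u < d \<Longrightarrow> k < n \<Longrightarrow>
        observation \<alpha> (p k) (A n p k u) = observation \<alpha> (p' k) (A n p' k u)"
      unfolding eventually_at_right_field by auto
    have "observation \<alpha> (p k) (A n p k u) = observation \<alpha> (p' k) (A n p' k u)"
      if "0 \<le> u" "u < min t d" "k < n" for u k
    proof (cases u \<sigma> rule: linorder_cases)
      case less
      then show ?thesis using H that by (auto simp: same_history_def)
    next
      case equal
      then show ?thesis using at_\<sigma> that by simp
    next
      case greater
      then show ?thesis using d(2)[of u k] that by simp
    qed
    then have "min t d \<in> G"
      using t d \<sigma> by (auto simp: G_def same_history_def)
    then have "min t d \<le> \<sigma>" unfolding \<sigma>_def by (rule cSup_upper[OF _ bdd])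
    then show False using d(1) \<sigma>t by simp
  qed
  then have "?H s"
    using H s by (auto simp: same_history_def)
  then show ?thesis using eq s k by blast
qed

text \<open>Two jobs no longer delay each other once one of them is finished.\<close>

definition pair_cost :: "(nat \<Rightarrow> real) \<Rightarrow> schedule \<Rightarrow> nat \<Rightarrow> nat \<Rightarrow> real" where
  "pair_cost p e a b = (let \<tau> = min (finish_time p e a) (finish_time p e b) in e a \<tau> + e b \<tau>)"

lemma pair_cost_commute: "pair_cost p e a b = pair_cost p e b a"
  by (simp add: pair_cost_def min.commute add.commute Let_def)

lemma pair_cost_bounds:
  assumes e: "feasible n p e" and a: "a < n" "finishes p e a" and b: "b < n" "finishes p e b"
  shows pair_cost_nonneg: "0 \<le> pair_cost p e a b"
    and pair_cost_le: "pair_cost p e a b \<le> e b (finish_time p e a) + e a (finish_time p e b)"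
proof -
  let ?\<tau> = "min (finish_time p e a) (finish_time p e b)"
  have "0 \<le> ?\<tau>"
    using finish_time_nonneg[OF e a] finish_time_nonneg[OF e b] by simp
  then show "0 \<le> pair_cost p e a b" "pair_cost p e a b \<le> e b (finish_time p e a) + e a (finish_time p e b)"
    using feasible_nonneg[OF e a(1)] feasible_nonneg[OF e b(1)]
      feasible_mono[OF e a(1), of ?\<tau> "finish_time p e b"]
      feasible_mono[OF e b(1), of ?\<tau> "finish_time p e a"]
    by (auto simp: pair_cost_def Let_def)
qed

text \<open>All jobs but \<open>a\<close> and \<open>b\<close> keep the processing times in
  \<open>p\<close>, while these two range over the levels. \<open>fin\<close> excludes infinite
  completion times.\<close>

locale two_jobs = pareto_levels +
  fixes A :: algorithm and n a b :: nat and p :: "nat \<Rightarrow> real"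
  assumes online: "online_algorithm \<alpha> A" and a: "a < n" and b: "b < n" and ab: "a \<noteq> b"
    and p: "valid_instance n p"
    and fin: "i \<le> K \<Longrightarrow> j \<le> K \<Longrightarrow>
      finishes (p(a := level i, b := level j)) (A n (p(a := level i, b := level j))) a \<and>
      finishes (p(a := level i, b := level j)) (A n (p(a := level i, b := level j))) b"
begin

definition inst :: "nat \<Rightarrow> nat \<Rightarrow> nat \<Rightarrow> real" where
  "inst i j = p(a := level i, b := level j)"

definition sched :: "nat \<Rightarrow> nat \<Rightarrow> schedule" where
  "sched i j = A n (inst i j)"

definition cost :: "nat \<Rightarrow> nat \<Rightarrow> real" where
  "cost i j = pair_cost (inst i j) (sched i j) a b"

abbreviation fin_a :: "nat \<Rightarrow> nat \<Rightarrow> real" where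
  "fin_a i j \<equiv> hit (sched i j a) (level i)"

abbreviation fin_b :: "nat \<Rightarrow> nat \<Rightarrow> real" where
  "fin_b i j \<equiv> hit (sched i j b) (level j)"

text \<open>As long as no signal has been emitted, the algorithm behaves as on the instance with two
  jobs of the top level.\<close>

definition signal_a :: "nat \<Rightarrow> real" where
  "signal_a i = hit (sched K K a) (\<alpha> * level i)"

definition signal_b :: "nat \<Rightarrow> real" where
  "signal_b j = hit (sched K K b) (\<alpha> * level j)"

lemma inst_simps [simp]: "inst i j a = level i" "inst i j b = level j"
  using ab by (auto simp: inst_def)

lemma valid_inst: "valid_instance n (inst i j)"
  using p level_pos by (auto simp: inst_def valid_instance_def)

lemma feas: "feasible n (inst i j) (sched i j)"
  using online valid_inst by (auto simp: online_algorithm_def sched_def)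

lemma finishes_a: "i \<le> K \<Longrightarrow> j \<le> K \<Longrightarrow> finishes (inst i j) (sched i j) a"
  and finishes_b: "i \<le> K \<Longrightarrow> j \<le> K \<Longrightarrow> finishes (inst i j) (sched i j) b"
  using fin by (auto simp: inst_def sched_def)

lemmas fin_a = finish_time[OF feas a finishes_a, simplified]
lemmas fin_b = finish_time[OF feas b finishes_b, simplified]

lemma alpha_level_le: "\<alpha> * level i \<le> level i"
  using \<alpha> level_pos[of i] mult_right_mono[of \<alpha> 1 "level i"] by simp

lemma alpha_level_mono: "i \<le> j \<Longrightarrow> \<alpha> * level i \<le> \<alpha> * level j"
  using \<alpha>(1) level_mono by (intro mult_left_mono) auto

lemma level_le_top: "level i \<le> level K"
  using level_mono[of i K] by (cases "i \<le> K") (auto simp: level_def)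

lemma alpha_level_le_top: "\<alpha> * level i \<le> level K"
  using alpha_level_le level_le_top by (rule order_trans)

lemma signal_a:
  shows signal_a_nonneg: "0 \<le> signal_a i" and signal_a_reached: "\<alpha> * level i \<le> sched K K a (signal_a i)"
    and before_signal_a: "\<And>s. 0 \<le> s \<Longrightarrow> s < signal_a i \<Longrightarrow> sched K K a s < \<alpha> * level i"
    and signal_a_mono: "i \<le> j \<Longrightarrow> signal_a i \<le> signal_a j"
proof -
  note h = hit[OF feasible_continuous[OF feas a]]
  have reach: "\<alpha> * level i \<le> sched K K a (fin_a K K)" for i
    using alpha_level_le_top[of i] fin_a(2)[of K K] by simp
  have t: "0 \<le> fin_a K K" using fin_a(1)[of K K] by simp
  note h' = h[OF t reach, folded signal_a_def]
  show s: "0 \<le> signal_a i" "\<alpha> * level i \<le> sched K K a (signal_a i)"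
    "\<And>s. 0 \<le> s \<Longrightarrow> s < signal_a i \<Longrightarrow> sched K K a s < \<alpha> * level i" for i
    using h' by auto
  show "signal_a i \<le> signal_a j" if "i \<le> j"
    unfolding signal_a_def[of i]
    by (rule h(2)) (use s[of j] alpha_level_mono[OF that] in auto)
qed

lemma sync:
  assumes "0 \<le> t"
    and "\<And>s. 0 \<le> s \<Longrightarrow> s < t \<Longrightarrow> i = i' \<or> sched i j a s < \<alpha> * level i \<and> sched i j a s < \<alpha> * level i'"
    and "\<And>s. 0 \<le> s \<Longrightarrow> s < t \<Longrightarrow> j = j' \<or> sched i j b s < \<alpha> * level j \<and> sched i j b s < \<alpha> * level j'"
    and "0 \<le> s" "s \<le> t" "k < n"
  shows "sched i j k s = sched i' j' k s"
  unfolding sched_def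
proof (rule online_sync[OF online valid_inst valid_inst \<alpha> assms(1) _ assms(4-6)])
  fix u l assume u: "0 \<le> u" "u < t" and "l < n"
  show "inst i j l = inst i' j' l \<or>
      A n (inst i j) l u < \<alpha> * inst i j l \<and> A n (inst i j) l u < \<alpha> * inst i' j' l"
    using assms(2)[OF u] assms(3)[OF u] ab by (auto simp: sched_def inst_def)
qed

lemma cost_nonneg: "i \<le> K \<Longrightarrow> j \<le> K \<Longrightarrow> 0 \<le> cost i j"
  unfolding cost_def by (rule pair_cost_nonneg[OF feas a finishes_a b finishes_b])

text \<open>Until \<open>a\<close> signals, the run is that on two top levels; afterwards it is that
  on levels \<open>i\<close> and \<open>K\<close> until \<open>b\<close> signals. In the latter run
  \<open>a\<close> finishes at \<open>C\<close>, when \<open>b\<close> has received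
  \<open>Y\<close>. If \<open>\<alpha> * level j \<le> Y\<close>, both jobs have passed their
  signals when the first of them finishes; otherwise the run is unchanged up to \<open>C\<close>,
  and neither finishes before. At level \<open>K\<close>, job \<open>b\<close> may finish first, but
  then it has cost \<open>level K\<close> itself. The facts on \<open>signal_b\<close> are
  hypotheses because they come from exchanging the jobs.\<close>

lemma cost_row:
  assumes i: "i < K"
    and down: "\<And>k j. Q k \<Longrightarrow> j \<le> k \<Longrightarrow> Q j"
    and Q: "\<And>j. Q j \<Longrightarrow> signal_b j \<le> signal_a i" "\<And>j. \<not> Q j \<Longrightarrow> signal_a i \<le> signal_b j"
    and signal_b_nonneg: "\<And>j. 0 \<le> signal_b j"
    and signal_b_reached: "\<And>j. \<alpha> * level j \<le> sched K K b (signal_b j)"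
    and before_signal_b: "\<And>j s. 0 \<le> s \<Longrightarrow> s < signal_b j \<Longrightarrow> sched K K b s < \<alpha> * level j"
  shows "row_condition i Q (cost i)"
proof -
  have iK: "i \<le> K" using i by simp
  define C where "C = fin_a i K"
  define Y where "Y = sched i K b C"
  note finC = fin_a[OF iK le_refl, folded C_def]
  have Y0: "0 \<le> Y"
    unfolding Y_def using feasible_nonneg[OF feas b finC(1)] .
  have Y_eq: "sched i j k s = sched i K k s"
    if "j \<le> K" "0 \<le> t" "sched i j b t < \<alpha> * level j" "0 \<le> s" "s \<le> t" "k < n" for j k s t
  proof (rule sync[OF that(2) _ _ that(4-6)])
    fix u assume "0 \<le> u" "u < t"
    then have "sched i j b u \<le> sched i j b t"
      using feasible_mono[OF feas b] by simp
    then show "j = K \<or> sched i j b u < \<alpha> * level j \<and> sched i j b u < \<alpha> * level K"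
      using that(3) alpha_level_mono[OF that(1)] by linarith
  qed simp
  have top: "sched K K k s = sched i j k s"
    if "signal_a i \<le> signal_b j \<or> j = K" "j \<le> K" "0 \<le> s" "s \<le> signal_a i" "k < n" for j k s
  proof (rule sync[OF signal_a_nonneg[of i] _ _ that(3-5)])
    fix u assume u: "0 \<le> u" "u < signal_a i"
    show "K = i \<or> sched K K a u < \<alpha> * level K \<and> sched K K a u < \<alpha> * level i"
      using before_signal_a[OF u] alpha_level_mono[OF iK] by simp
    show "K = j \<or> sched K K b u < \<alpha> * level K \<and> sched K K b u < \<alpha> * level j"
      using before_signal_b[OF u(1), of j] u(2) that(1) alpha_level_mono[OF that(2)] by auto
  qed
  have "\<alpha> * level j \<le> Y" if "Q j" for j
  proof -
    have "signal_a i \<le> C"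
    proof (rule ccontr)
      assume "\<not> ?thesis"
      then have "sched K K a C < \<alpha> * level i" "sched K K a C = sched i K a C"
        using before_signal_a[OF finC(1), of i] finC(1) top[of K C a] a by simp_all
      then show False using finC(2) alpha_level_le[of i] by simp
    qed
    have "\<alpha> * level j \<le> sched K K b (signal_b j)" by (rule signal_b_reached)
    also have "\<dots> = sched i K b (signal_b j)"
      using top[of K "signal_b j" b] signal_b_nonneg Q(1)[OF that] b by simp
    also have "\<dots> \<le> Y"
      unfolding Y_def using Q(1)[OF that] \<open>signal_a i \<le> C\<close> signal_b_nonneg
      by (intro feasible_mono[OF feas b]) auto
    finally show ?thesis .
  qed
  moreover have "min (level i) (level j) + \<alpha> * max (level i) (level j) \<le> cost i j"
    if j: "j < K" "\<not> Q j" "\<alpha> * level j \<le> Y" for j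
  proof -
    have jK: "j \<le> K" using j by simp
    note fa = fin_a[OF iK jK] and fb = fin_b[OF iK jK]
    define \<tau> where "\<tau> = min (fin_a i j) (fin_b i j)"
    have \<tau>0: "0 \<le> \<tau>" using fa(1) fb(1) by (simp add: \<tau>_def)
    have \<tau>: "sched i j a \<tau> = level i \<or> sched i j b \<tau> = level j"
      using fa(2) fb(2) by (auto simp: \<tau>_def min_def)
    have "signal_a i \<le> \<tau>"
    proof (rule ccontr)
      assume "\<not> ?thesis"
      then have "sched K K a \<tau> < \<alpha> * level i" "sched K K b \<tau> < \<alpha> * level j"
        "sched K K a \<tau> = sched i j a \<tau>" "sched K K b \<tau> = sched i j b \<tau>"
        using before_signal_a[OF \<tau>0, of i] before_signal_b[OF \<tau>0, of j] Q(2)[OF j(2)]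
          \<tau>0 top[of j \<tau>] a b jK by simp_all
      then show False
        using \<tau> alpha_level_le[of i] alpha_level_le[of j] by auto
    qed
    then have "sched i j a (signal_a i) \<le> sched i j a \<tau>"
      by (intro feasible_mono[OF feas a signal_a_nonneg])
    then have "\<alpha> * level i \<le> sched i j a \<tau>"
      using signal_a_reached[of i] top[of j "signal_a i" a] Q(2)[OF j(2)] jK a signal_a_nonneg by auto
    moreover have "\<alpha> * level j \<le> sched i j b \<tau>"
    proof (rule ccontr)
      assume "\<not> ?thesis"
      then have small: "sched i j b \<tau> < \<alpha> * level j" by simp
      then have eq: "sched i j k \<tau> = sched i K k \<tau>" if "k < n" for k
        using Y_eq[OF jK \<tau>0 _ \<tau>0 _ that] by simp
      have "sched i K a \<tau> = level i"
        using \<tau> small alpha_level_le[of j] eq[OF a] by auto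
      then have "C \<le> \<tau>" using finC(4)[OF \<tau>0] by force
      then have "Y \<le> sched i K b \<tau>"
        unfolding Y_def by (rule feasible_mono[OF feas b finC(1)])
      then show False using small eq[OF b] j(3) by simp
    qed
    moreover have "cost i j = sched i j a \<tau> + sched i j b \<tau>"
      by (simp add: cost_def pair_cost_def Let_def \<tau>_def)
    \<comment> \<open>Either job may be the one that finishes first; as \<alpha> \<le> 1, the
      cheaper case is the shorter job finishing.\<close>
    moreover have "level i + \<alpha> * level j \<ge> min (level i) (level j) + \<alpha> * max (level i) (level j)"
      "\<alpha> * level i + level j \<ge> min (level i) (level j) + \<alpha> * max (level i) (level j)"
      using mult_nonneg_nonneg[of "1 - \<alpha>" "level i - level j"]
        mult_nonneg_nonneg[of "1 - \<alpha>" "level j - level i"] \<alpha>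
      by (auto simp: min_def max_def algebra_simps)
    ultimately show ?thesis using \<tau> by linarith
  qed
  moreover have "level i + Y \<le> cost i j" if j: "j < K" "Y < \<alpha> * level j" for j
  proof -
    have jK: "j \<le> K" using j by simp
    note fa = fin_a[OF iK jK] and fb = fin_b[OF iK jK]
    have eq: "sched i K k s = sched i j k s" if "0 \<le> s" "s \<le> C" "k < n" for k s
    proof (rule sync[OF finC(1) _ _ that])
      fix u assume "0 \<le> u" "u < C"
      then have "sched i K b u \<le> Y"
        unfolding Y_def using feasible_mono[OF feas b] by simp
      then show "K = j \<or> sched i K b u < \<alpha> * level K \<and> sched i K b u < \<alpha> * level j"
        using j(2) alpha_level_mono[OF jK] by linarith
    qed simp
    have "C \<le> fin_a i j"
    proof (rule ccontr)
      assume "\<not> ?thesis"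
      then show False using eq[OF fa(1) _ a] finC(4)[OF fa(1)] fa(2) by simp
    qed
    moreover have "C \<le> fin_b i j"
    proof (rule ccontr)
      assume "\<not> ?thesis"
      then have "sched i j b (fin_b i j) \<le> Y"
        using eq[OF fb(1) _ b] feasible_mono[OF feas b fb(1), of C i K] by (simp add: Y_def)
      then show False using fb(2) j(2) alpha_level_le[of j] by simp
    qed
    ultimately have "C \<le> min (fin_a i j) (fin_b i j)" by simp
    then have "sched i j a C + sched i j b C \<le> cost i j"
      unfolding cost_def pair_cost_def Let_def inst_simps
      by (intro add_mono feasible_mono[OF feas a finC(1)] feasible_mono[OF feas b finC(1)])
    then show ?thesis
      using eq[OF finC(1) _ a] eq[OF finC(1) _ b] finC(2) by (simp add: Y_def)
  qed
  moreover have "min (level i + Y) (level K) \<le> cost i K"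
  proof (cases "C \<le> fin_b i K")
    case True
    then have "cost i K = level i + Y"
      using finC(2) by (simp add: cost_def pair_cost_def Let_def Y_def C_def min_def)
    then show ?thesis by simp
  next
    case False
    then have "cost i K = sched i K a (fin_b i K) + level K"
      using fin_b(2)[OF iK] by (simp add: cost_def pair_cost_def Let_def C_def min_def)
    moreover have "0 \<le> sched i K a (fin_b i K)"
      using fin_b(1)[OF iK] by (intro feasible_nonneg[OF feas a]) auto
    ultimately show ?thesis by simp
  qed
  ultimately show ?thesis
    unfolding row_condition_def using down Y0 by blast
qed

end

text \<open>The columns are the rows after exchanging the two jobs. Simultaneous signals are
  assigned to the rows, since \<open>B\<close> is strict.\<close>

lemma (in two_jobs) cost_bound:
  "2 * (1 + \<alpha>) * K * (1 - 1 / \<mu>) / \<mu>\<^sup>2 - 1 \<le> (\<Sum>i\<le>K. \<Sum>j\<le>K. weight i * weight j * cost i j)"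
proof -
  interpret swap: two_jobs \<alpha> \<mu> K A n b a p
    using online a b ab p fin by unfold_locales (auto simp: fun_upd_twist[of a b])
  have inst: "swap.inst j i = inst i j" for i j
    using ab by (simp add: inst_def swap.inst_def fun_upd_twist)
  then have sched: "swap.sched j i = sched i j" for i j
    by (simp add: sched_def swap.sched_def)
  have cost: "swap.cost j i = cost i j" for i j
    by (simp add: cost_def swap.cost_def inst sched pair_cost_commute)
  have sig: "swap.signal_a = signal_b" "swap.signal_b = signal_a"
    by (auto simp: fun_eq_iff signal_a_def signal_b_def swap.signal_a_def swap.signal_b_def sched)
  note b_facts = swap.signal_a[unfolded sig sched]
  define B where "B = (\<lambda>i j. signal_b j < signal_a i)"
  show ?thesis
  proof (rule pair_bound[of B])
    fix i assume "i < K"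
    then show "row_condition i (B i) (cost i)"
      using b_facts(1-3) by (intro cost_row) (auto simp: B_def intro: le_less_trans[OF b_facts(4)])
  next
    fix j assume "j < K"
    then have "row_condition j (\<lambda>i. \<not> B i j) (swap.cost j)"
      using signal_a(1-3)
      by (intro swap.cost_row) (auto simp: B_def sig sched not_less intro: order_trans[OF signal_a(4)])
    then show "row_condition j (\<lambda>i. \<not> B i j) (\<lambda>i. cost i j)"
      unfolding cost .
  next
    show "0 \<le> cost K K" by (rule cost_nonneg) auto
  qed
qed

section \<open>Averaging over many jobs\<close>

context pareto_levels
begin

text \<open>Extensional functions keep this set finite, so the product distribution is a finite
  weighted sum.\<close>

definition configs :: "nat \<Rightarrow> (nat \<Rightarrow> nat) set" where
  "configs n = {..<n} \<rightarrow>\<^sub>E {..K}"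

definition config_prob :: "nat \<Rightarrow> (nat \<Rightarrow> nat) \<Rightarrow> real" where
  "config_prob n f = (\<Prod>k<n. weight (f k))"

definition mean :: "nat \<Rightarrow> ((nat \<Rightarrow> nat) \<Rightarrow> real) \<Rightarrow> real" where
  "mean n h = (\<Sum>f\<in>configs n. config_prob n f * h f)"

lemma finite_configs [simp]: "finite (configs n)"
  by (simp add: configs_def finite_PiE)

lemma configs_update: "f \<in> configs n \<Longrightarrow> a < n \<Longrightarrow> i \<le> K \<Longrightarrow> f(a := i) \<in> configs n"
  by (auto simp: configs_def PiE_def extensional_def Pi_def)

lemma config_prob_nonneg: "0 \<le> config_prob n f"
  unfolding config_prob_def by (intro prod_nonneg) (simp add: weight_nonneg)

lemma config_prob_pos: "0 < config_prob n f"
  unfolding config_prob_def using \<mu> by (intro prod_pos) (auto simp: weight_def)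

lemma mean_mono: "(\<And>f. f \<in> configs n \<Longrightarrow> g f \<le> h f) \<Longrightarrow> mean n g \<le> mean n h"
  unfolding mean_def by (intro sum_mono mult_left_mono config_prob_nonneg)

lemma mean_sum: "mean n (\<lambda>f. \<Sum>x\<in>X. h x f) = (\<Sum>x\<in>X. mean n (h x))"
  unfolding mean_def by (simp only: sum_distrib_left) (rule sum.swap)

lemma mean_cmult: "mean n (\<lambda>f. c * h f) = c * mean n h"
  by (simp add: mean_def sum_distrib_left mult.left_commute)

lemma mean_const: "mean n (\<lambda>_. c) = c"
proof -
  have "(\<Sum>f\<in>configs n. config_prob n f) = (\<Prod>k<n. \<Sum>i\<le>K. weight i)"
    unfolding configs_def config_prob_def by (rule prod_sum_PiE[symmetric]) auto
  then show ?thesis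
    by (simp add: mean_def sum_weight flip: sum_distrib_right)
qed

text \<open>The form in which independence is used: after redrawing the levels of two jobs, the
  others are frozen and the bound for two jobs applies.\<close>

lemma mean_resample:
  assumes a: "a < n"
  shows "mean n h = mean n (\<lambda>f. \<Sum>i\<le>K. weight i * h (f(a := i)))"
proof -
  define I where "I = {..<n} - {a}"
  have I: "{..<n} = insert a I" "a \<notin> I" "finite I"
    using a by (auto simp: I_def)
  have split: "mean n g = (\<Sum>i\<le>K. \<Sum>f\<in>I \<rightarrow>\<^sub>E {..K}. weight i * (\<Prod>k\<in>I. weight (f k)) * g (f(a := i)))" for g
  proof -
    have "mean n g = (\<Sum>x\<in>{..K} \<times> (I \<rightarrow>\<^sub>E {..K}). config_prob n ((\<lambda>(i, f). f(a := i)) x) * g ((\<lambda>(i, f). f(a := i)) x))"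
      unfolding mean_def configs_def I(1) PiE_insert_eq
      by (subst sum.reindex[OF inj_combinator[OF I(2)]]) simp
    also have "\<dots> = (\<Sum>i\<le>K. \<Sum>f\<in>I \<rightarrow>\<^sub>E {..K}. config_prob n (f(a := i)) * g (f(a := i)))"
      by (simp add: sum.cartesian_product case_prod_unfold)
    also have "\<dots> = (\<Sum>i\<le>K. \<Sum>f\<in>I \<rightarrow>\<^sub>E {..K}. weight i * (\<Prod>k\<in>I. weight (f k)) * g (f(a := i)))"
    proof (intro sum.cong refl)
      fix f i
      have "config_prob n (f(a := i)) = weight i * (\<Prod>k\<in>I. weight ((f(a := i)) k))"
        unfolding config_prob_def I(1) using I(2,3) by simp
      also have "(\<Prod>k\<in>I. weight ((f(a := i)) k)) = (\<Prod>k\<in>I. weight (f k))"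
        using I(2) by (intro prod.cong) auto
      finally show "config_prob n (f(a := i)) * g (f(a := i))
          = weight i * (\<Prod>k\<in>I. weight (f k)) * g (f(a := i))" by (rule arg_cong)
    qed
    finally show ?thesis .
  qed
  have "mean n (\<lambda>f. h (f(a := i))) = (\<Sum>f\<in>I \<rightarrow>\<^sub>E {..K}. (\<Prod>k\<in>I. weight (f k)) * h (f(a := i)))" for i
    unfolding split using sum_weight
    by (simp add: mult.assoc flip: sum_distrib_left sum_distrib_right)
  then show ?thesis
    unfolding mean_sum mean_cmult by (simp add: split[of h] sum_distrib_left mult.assoc)
qed

lemma mean_resample2:
  assumes "a < n" "b < n"
  shows "mean n h = mean n (\<lambda>f. \<Sum>i\<le>K. \<Sum>j\<le>K. weight i * weight j * h (f(a := i, b := j)))"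
proof -
  have "mean n h = mean n (\<lambda>f. \<Sum>j\<le>K. weight j * h (f(b := j)))"
    by (rule mean_resample[OF assms(2)])
  also have "\<dots> = mean n (\<lambda>f. \<Sum>i\<le>K. weight i * (\<Sum>j\<le>K. weight j * h (f(a := i, b := j))))"
    by (rule mean_resample[OF assms(1)])
  finally show ?thesis by (simp add: sum_distrib_left mult.assoc)
qed

definition proc_times :: "(nat \<Rightarrow> nat) \<Rightarrow> nat \<Rightarrow> real" where
  "proc_times f k = level (f k)"

lemma proc_times_update: "proc_times (f(a := i, b := j)) = (proc_times f)(a := level i, b := level j)"
  by (auto simp: proc_times_def fun_eq_iff)

lemma valid_proc_times: "valid_instance n (proc_times f)"
  using level_pos by (simp add: valid_instance_def proc_times_def)

definition pair_lower :: real where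
  "pair_lower = 2 * (1 + \<alpha>) * K * (1 - 1 / \<mu>) / \<mu>\<^sup>2 - 1"

definition pair_upper :: real where
  "pair_upper = 2 * K * (1 - 1 / \<mu>) + 3"

lemma mean_spt_cost_le:
  "2 * mean n (\<lambda>f. spt_cost n (proc_times f))
    \<le> n * (2 * (\<Sum>i\<le>K. weight i * level i) + (real n - 1) * pair_upper)"
proof -
  let ?D = "\<Sum>i\<le>K. weight i * level i"
  have "2 * mean n (\<lambda>f. spt_cost n (proc_times f))
      = (\<Sum>j<n. \<Sum>k<n. mean n (\<lambda>f. min (proc_times f j) (proc_times f k) + (if k = j then proc_times f j else 0)))"
    unfolding mean_cmult[symmetric] spt_cost_alt mean_sum ..
  also have "\<dots> \<le> (\<Sum>j<n. \<Sum>k<n. pair_upper + (if k = j then 2 * ?D - pair_upper else 0))"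
  proof (intro sum_mono)
    fix j k assume "j \<in> {..<n}" "k \<in> {..<n}"
    then have jk: "j < n" "k < n" by auto
    show "mean n (\<lambda>f. min (proc_times f j) (proc_times f k) + (if k = j then proc_times f j else 0))
        \<le> pair_upper + (if k = j then 2 * ?D - pair_upper else 0)"
    proof (cases "k = j")
      case True
      have "mean n (\<lambda>f. proc_times f j) = mean n (\<lambda>f. ?D)"
        by (subst mean_resample[OF jk(1)]) (simp add: proc_times_def)
      then show ?thesis
        using True mean_cmult[of n 2 "\<lambda>f. proc_times f j"] by (simp add: mean_const)
    next
      case False
      have "mean n (\<lambda>f. min (proc_times f j) (proc_times f k))
          = mean n (\<lambda>f. \<Sum>i\<le>K. \<Sum>i'\<le>K. weight i * weight i' * min (level i) (level i'))"
        using False by (subst mean_resample2[OF jk]) (simp add: proc_times_def)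
      then show ?thesis
        using False expected_min_le by (simp add: mean_const pair_upper_def)
    qed
  qed
  also have "\<dots> = n * (2 * ?D + (real n - 1) * pair_upper)"
    by (simp add: sum.distrib algebra_simps)
  finally show ?thesis .
qed

text \<open>Each ordered pair of distinct jobs contributes \<open>pair_lower\<close> in the mean;
  the diagonal is bounded by 0.\<close>

lemma mean_finish_times_ge:
  assumes A: "online_algorithm \<alpha> A"
    and fin: "\<And>f j. f \<in> configs n \<Longrightarrow> j < n \<Longrightarrow> finishes (proc_times f) (A n (proc_times f)) j"
  shows "n * ((real n - 1) * pair_lower)
    \<le> 2 * mean n (\<lambda>f. \<Sum>j<n. finish_time (proc_times f) (A n (proc_times f)) j)"
proof -
  let ?C = "\<lambda>f j. finish_time (proc_times f) (A n (proc_times f)) j"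
  have feas: "feasible n (proc_times f) (A n (proc_times f))" for f
    using A valid_proc_times by (auto simp: online_algorithm_def)
  define c where "c = (\<lambda>j k f. if k = j then 0 else pair_cost (proc_times f) (A n (proc_times f)) j k)"
  have "n * ((real n - 1) * pair_lower) = (\<Sum>j<n. \<Sum>k<n. pair_lower + (if k = j then - pair_lower else 0))"
    by (simp add: sum.distrib algebra_simps)
  also have "\<dots> \<le> (\<Sum>j<n. \<Sum>k<n. mean n (c j k))"
  proof (intro sum_mono)
    fix j k assume "j \<in> {..<n}" "k \<in> {..<n}"
    then have jk: "j < n" "k < n" by auto
    show "pair_lower + (if k = j then - pair_lower else 0) \<le> mean n (c j k)"
    proof (cases "k = j")
      case True
      then show ?thesis by (simp add: c_def mean_const)
    next
      case False
      have "mean n (\<lambda>_. pair_lower)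
          \<le> mean n (\<lambda>f. \<Sum>i\<le>K. \<Sum>i'\<le>K. weight i * weight i' * c j k (f(j := i, k := i')))"
      proof (rule mean_mono)
        fix f assume f: "f \<in> configs n"
        interpret two_jobs \<alpha> \<mu> K A n j k "proc_times f"
        proof
          fix i i' assume "i \<le> K" "i' \<le> K"
          then have "f(j := i, k := i') \<in> configs n"
            using f jk by (intro configs_update)
          from fin[OF this jk(1)] fin[OF this jk(2)]
          show "finishes ((proc_times f)(j := level i, k := level i'))
                (A n ((proc_times f)(j := level i, k := level i'))) j \<and>
              finishes ((proc_times f)(j := level i, k := level i'))
                (A n ((proc_times f)(j := level i, k := level i'))) k"
            by (simp add: proc_times_update)
        qed (use A jk False valid_proc_times in auto)
        show "pair_lower \<le> (\<Sum>i\<le>K. \<Sum>i'\<le>K. weight i * weight i' * c j k (f(j := i, k := i')))"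
          using cost_bound False
          by (simp add: pair_lower_def c_def cost_def inst_def sched_def proc_times_update)
      qed
      then show ?thesis
        using False by (simp add: mean_const flip: mean_resample2[OF jk])
    qed
  qed
  also have "\<dots> = mean n (\<lambda>f. \<Sum>j<n. \<Sum>k<n. c j k f)"
    by (simp add: mean_sum)
  also have "\<dots> \<le> mean n (\<lambda>f. 2 * (\<Sum>j<n. ?C f j))"
  proof (rule mean_mono)
    fix f assume f: "f \<in> configs n"
    note fin_f = fin[OF f]
    let ?e = "A n (proc_times f)"
    have "(\<Sum>j<n. \<Sum>k<n. c j k f) \<le> (\<Sum>j<n. \<Sum>k<n. ?e k (?C f j) + ?e j (?C f k))"
    proof (intro sum_mono)
      fix j k assume "j \<in> {..<n}" "k \<in> {..<n}"
      then have jk: "j < n" "k < n" by auto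
      show "c j k f \<le> ?e k (?C f j) + ?e j (?C f k)"
        using pair_cost_le[OF feas jk(1) fin_f[OF jk(1)] jk(2) fin_f[OF jk(2)]]
          feasible_nonneg[OF feas jk(1) finish_time_nonneg[OF feas jk(2) fin_f[OF jk(2)]]]
          feasible_nonneg[OF feas jk(2) finish_time_nonneg[OF feas jk(1) fin_f[OF jk(1)]]]
        by (cases "k = j") (simp_all add: c_def)
    qed
    also have "\<dots> \<le> 2 * (\<Sum>j<n. ?C f j)"
      by (rule pairwise_delays_le_finish_times[OF feas fin_f])
    finally show "(\<Sum>j<n. \<Sum>k<n. c j k f) \<le> 2 * (\<Sum>j<n. ?C f j)" .
  qed
  finally show ?thesis by (simp add: mean_cmult)
qed

text \<open>Every configuration has positive probability, so a single unfinished job makes the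
  average infinite.\<close>

lemma average_total_completion_time_ge:
  assumes A: "online_algorithm \<alpha> A"
  shows "ennreal (n * ((real n - 1) * pair_lower) / 2)
    \<le> (\<Sum>f\<in>configs n. ennreal (config_prob n f) * total_completion_time n (proc_times f) (A n (proc_times f)))"
proof (cases "\<forall>f\<in>configs n. \<forall>j<n. finishes (proc_times f) (A n (proc_times f)) j")
  case True
  let ?C = "\<lambda>f j. finish_time (proc_times f) (A n (proc_times f)) j"
  have feas: "feasible n (proc_times f) (A n (proc_times f))" for f
    using A valid_proc_times by (auto simp: online_algorithm_def)
  have nonneg: "0 \<le> (\<Sum>j<n. ?C f j)" if "f \<in> configs n" for f
    using True that by (intro sum_nonneg finish_time_nonneg[OF feas]) auto
  have "(\<Sum>f\<in>configs n. ennreal (config_prob n f) * total_completion_time n (proc_times f) (A n (proc_times f)))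
      = (\<Sum>f\<in>configs n. ennreal (config_prob n f * (\<Sum>j<n. ?C f j)))"
  proof (rule sum.cong)
    fix f assume f: "f \<in> configs n"
    then have "total_completion_time n (proc_times f) (A n (proc_times f)) = ennreal (\<Sum>j<n. ?C f j)"
      using True by (intro total_completion_time_eq[OF feas]) auto
    then show "ennreal (config_prob n f) * total_completion_time n (proc_times f) (A n (proc_times f))
        = ennreal (config_prob n f * (\<Sum>j<n. ?C f j))"
      using config_prob_nonneg nonneg[OF f] by (simp add: ennreal_mult)
  qed simp
  also have "\<dots> = ennreal (mean n (\<lambda>f. \<Sum>j<n. ?C f j))"
    unfolding mean_def using config_prob_nonneg nonneg by (intro sum_ennreal mult_nonneg_nonneg)
  finally have total: "(\<Sum>f\<in>configs n. ennreal (config_prob n f) * total_completion_time n (proc_times f) (A n (proc_times f)))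
      = ennreal (mean n (\<lambda>f. \<Sum>j<n. ?C f j))" .
  have "n * ((real n - 1) * pair_lower) \<le> 2 * mean n (\<lambda>f. \<Sum>j<n. ?C f j)"
    by (rule mean_finish_times_ge[OF A]) (use True in auto)
  then show ?thesis
    unfolding total by (intro ennreal_leI) simp
next
  case False
  then obtain f j where "f \<in> configs n" "j < n" "\<not> finishes (proc_times f) (A n (proc_times f)) j" by blast
  then have "ennreal (config_prob n f) * total_completion_time n (proc_times f) (A n (proc_times f)) = \<top>"
    using config_prob_pos[of n f] total_completion_time_not_finishes[of j n]
    by (simp add: ennreal_mult_top)
  then have "(\<Sum>f\<in>configs n. ennreal (config_prob n f) * total_completion_time n (proc_times f) (A n (proc_times f))) = \<top>"
    using \<open>f \<in> configs n\<close> by (auto simp: ennreal_sum_eq_top)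
  then show ?thesis by (simp only: top_greatest)
qed

text \<open>Yao's principle: the bound holds for every deterministic choice on average over the
  configurations, and finite averaging commutes with the integral. \<open>max 0 c\<close> appears
  since \<open>ennreal\<close> maps negative \<open>c\<close> to 0.\<close>

lemma competitive_ratio_ge:
  assumes R: "randomized_online_algorithm \<alpha> M R" and comp: "competitive_in_expectation M R c"
  shows "n * ((real n - 1) * pair_lower)
    \<le> max 0 c * (n * (2 * (\<Sum>i\<le>K. weight i * level i) + (real n - 1) * pair_upper))"
proof -
  let ?T = "\<lambda>f \<omega>. total_completion_time n (proc_times f) (R \<omega> n (proc_times f))"
  have M: "emeasure M (space M) = 1"
    using R by (auto simp: randomized_online_algorithm_def intro: prob_space.emeasure_space_1)
  have meas: "?T f \<in> borel_measurable M" for f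
    using R valid_proc_times by (auto simp: randomized_online_algorithm_def)
  have "ennreal (n * ((real n - 1) * pair_lower) / 2)
      = (\<integral>\<^sup>+\<omega>. ennreal (n * ((real n - 1) * pair_lower) / 2) \<partial>M)"
    by (simp add: M)
  also have "\<dots> \<le> (\<integral>\<^sup>+\<omega>. (\<Sum>f\<in>configs n. ennreal (config_prob n f) * ?T f \<omega>) \<partial>M)"
    using R by (intro nn_integral_mono average_total_completion_time_ge)
      (auto simp: randomized_online_algorithm_def)
  also have "\<dots> = (\<Sum>f\<in>configs n. ennreal (config_prob n f) * (\<integral>\<^sup>+\<omega>. ?T f \<omega> \<partial>M))"
    using meas by (simp add: nn_integral_sum nn_integral_cmult)
  also have "\<dots> \<le> (\<Sum>f\<in>configs n. ennreal (config_prob n f) * (ennreal c * opt n (proc_times f)))"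
    using comp valid_proc_times unfolding competitive_in_expectation_def
    by (intro sum_mono mult_left_mono) auto
  also have "\<dots> = (\<Sum>f\<in>configs n. ennreal (max 0 c * (config_prob n f * spt_cost n (proc_times f))))"
  proof (rule sum.cong)
    fix f
    have "ennreal c = ennreal (max 0 c)" by (simp add: max_def ennreal_neg)
    then show "ennreal (config_prob n f) * (ennreal c * opt n (proc_times f))
        = ennreal (max 0 c * (config_prob n f * spt_cost n (proc_times f)))"
      using config_prob_nonneg[of n f] spt_cost_nonneg[OF valid_proc_times, of n f] opt_eq_spt_cost[OF valid_proc_times, of n f]
      by (simp add: ennreal_mult mult_ac)
  qed simp
  also have "\<dots> = ennreal (max 0 c * mean n (\<lambda>f. spt_cost n (proc_times f)))"
    unfolding mean_def sum_distrib_left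
    using config_prob_nonneg spt_cost_nonneg[OF valid_proc_times]
    by (intro sum_ennreal) (auto intro!: mult_nonneg_nonneg)
  finally have "ennreal (n * ((real n - 1) * pair_lower) / 2)
      \<le> ennreal (max 0 c * mean n (\<lambda>f. spt_cost n (proc_times f)))" .
  moreover have "0 \<le> mean n (\<lambda>f. spt_cost n (proc_times f))"
    using mean_mono[of n "\<lambda>_. 0"] spt_cost_nonneg[OF valid_proc_times] by (simp add: mean_const)
  ultimately have "n * ((real n - 1) * pair_lower) / 2 \<le> max 0 c * mean n (\<lambda>f. spt_cost n (proc_times f))"
    by (subst (asm) ennreal_le_iff) auto
  also have "\<dots> \<le> max 0 c * (n * (2 * (\<Sum>i\<le>K. weight i * level i) + (real n - 1) * pair_upper) / 2)"
    using mean_spt_cost_le[of n] by (intro mult_left_mono) auto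
  finally show ?thesis by simp
qed

end

section \<open>The limits in the number of jobs, the number of levels and \<mu>\<close>

lemma nat_mult_bounded_imp_nonpos:
  fixes x y :: real
  assumes "\<And>N :: nat. N * x \<le> y"
  shows "x \<le> 0"
proof (rule ccontr)
  assume "\<not> x \<le> 0"
  then obtain N :: nat where "y < N * x"
    using reals_Archimedean3[of x] by auto
  then show False using assms[of N] by simp
qed

text \<open>The number of jobs goes to infinity first, which removes the term \<open>D\<close> of
  single jobs, as \<open>D\<close> depends on \<open>K\<close>. Then \<open>K\<close> removes the
  constants 1 and 3, and finally \<mu> tending to 1 removes the loss \<mu>^2 of the
  discretisation.\<close>

lemma randomized_lower_bound:
  assumes \<alpha>: "0 \<le> \<alpha>" "\<alpha> \<le> 1"
    and R: "randomized_online_algorithm \<alpha> M R" and comp: "competitive_in_expectation M R c"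
  shows "1 + \<alpha> \<le> c"
proof -
  define c' where "c' = max 0 c"
  have "1 + \<alpha> \<le> c' * \<mu>\<^sup>2" if \<mu>: "1 < \<mu>" for \<mu> :: real
  proof -
    define \<theta> where "\<theta> = 1 - 1 / \<mu>"
    have \<theta>: "0 < \<theta>" using \<mu> by (simp add: \<theta>_def)
    have "K * (2 * \<theta> * ((1 + \<alpha>) / \<mu>\<^sup>2 - c')) \<le> 3 * c' + 1" for K :: nat
    proof -
      interpret pareto_levels \<alpha> \<mu> K by standard (fact \<alpha> \<mu>)+
      define D where "D = (\<Sum>i\<le>K. weight i * level i)"
      have "N * (pair_lower - c' * pair_upper) \<le> 2 * c' * D" for N :: nat
      proof -
        have "Suc N * (N * pair_lower) \<le> Suc N * (c' * (2 * D + N * pair_upper))"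
          using competitive_ratio_ge[OF R comp, of "Suc N"]
          by (simp add: c'_def D_def mult.left_commute del: of_nat_Suc) (simp add: algebra_simps)
        then have "N * pair_lower \<le> c' * (2 * D + N * pair_upper)"
          by (simp only: mult_le_cancel_left_pos of_nat_0_less_iff zero_less_Suc)
        then show ?thesis by (simp add: algebra_simps)
      qed
      then have "pair_lower - c' * pair_upper \<le> 0"
        by (rule nat_mult_bounded_imp_nonpos)
      then show ?thesis
        by (simp add: pair_lower_def pair_upper_def algebra_simps flip: \<theta>_def)
    qed
    then have "2 * \<theta> * ((1 + \<alpha>) / \<mu>\<^sup>2 - c') \<le> 0"
      by (rule nat_mult_bounded_imp_nonpos)
    then have "(1 + \<alpha>) / \<mu>\<^sup>2 - c' \<le> 0"
      using \<theta> by (simp add: mult_le_0_iff)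
    then show ?thesis using \<mu> by (simp add: field_simps)
  qed
  then have "\<forall>\<^sub>F \<mu> in at_right (1 :: real). 1 + \<alpha> \<le> c' * \<mu>\<^sup>2"
    using eventually_at_right_less by (rule eventually_mono[rotated])
  moreover have "((\<lambda>\<mu> :: real. c' * \<mu>\<^sup>2) \<longlongrightarrow> c' * 1\<^sup>2) (at_right 1)"
    by (intro tendsto_intros)
  ultimately have "1 + \<alpha> \<le> c' * 1\<^sup>2"
    by (intro tendsto_lowerbound) auto
  \<comment> \<open>As 1 + \<alpha> is positive, \<open>c'\<close> cannot be 0 and hence equals
    \<open>c\<close>.\<close>
  then show ?thesis using \<alpha> by (simp add: c'_def max_def split: if_splits)
qed

theorem theorem1:
  fixes \<alpha> :: real
  assumes "0 \<le> \<alpha>" and "\<alpha> \<le> 1"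
  shows "(\<exists>A. signal_round_robin \<alpha> A) \<and>
    (\<forall>A. signal_round_robin \<alpha> A \<longrightarrow> online_algorithm \<alpha> A \<and> competitive A (1 + \<alpha>)) \<and>
    (\<forall>(M :: 'w measure) R c.
       randomized_online_algorithm \<alpha> M R \<and> competitive_in_expectation M R c \<longrightarrow> 1 + \<alpha> \<le> c)"
  using signal_round_robin_exists[OF assms(2)] signal_round_robin_online
    signal_round_robin_competitive[OF _ assms(1)] randomized_lower_bound[OF assms]
  by blast

end
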